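(* Suppose $\mathbf{Y}\sim SE_k(\boldsymbol{\mu},\mathbf{\Omega},\boldsymbol{\delta},g^{(k+1)})$ and the first three moments of $\mathbf{Y}$ exist. Then the Mardia measure of skewness of $\mathbf{Y}$ is $$\beta_{1,k}=\frac{[3(c-ab)\delta_{\ast}+(2a^3-c)\delta_{\ast}^3]^2}{(b-a^2\delta_{\ast}^2)^3}+\frac{3(k-1)(c-ab)^2\delta_{\ast}^2}{b^2(b-a^2\delta_{\ast}^2)},$$ where $\delta_{\ast}=\boldsymbol{\delta}^{\top}\mathbf{\Omega}^{-1}\boldsymbol{\delta}$, $a=\frac{\mathrm{E}[R]}{\mathrm{E}[R_0]}\sqrt{\frac{2}{\pi}}$, $b=\frac{\mathrm{E}[R^2]}{\mathrm{E}[R_0^2]}$ and $c=\frac{\mathrm{E}[R^3]}{\mathrm{E}[R_0^3]}\sqrt{\frac{2}{\pi}}$.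
   Context: Skew-elliptical distribution: let $\boldsymbol{\mu}\in\mathbb{R}^k$, let $\mathbf{\Omega}$ be a $k\times k$ symmetric positive definite matrix, let $\boldsymbol{\delta}\in\mathbb{R}^k$ with $\boldsymbol{\delta}^{\top}\mathbf{\Omega}^{-1}\boldsymbol{\delta}<1$, and let $g^{(k+1)}$ be a spherical $(k+1)$-dimensional density generator, i.e. a nonnegative function on $[0,\infty)$ such that $\boldsymbol{x}\mapsto g^{(k+1)}(\boldsymbol{x}^{\top}\boldsymbol{x})$ is a probability density on $\mathbb{R}^{k+1}$. One writes $\mathbf{Y}\sim SE_k(\boldsymbol{\mu},\mathbf{\Omega},\boldsymbol{\delta},g^{(k+1)})$ if the random vector $\mathbf{Y}$ in $\mathbb{R}^k$ has density $$f_{\mathbf{Y}}(\boldsymbol{y})=2|\mathbf{\Omega}|^{-1/2}\int_{-\infty}^{\boldsymbol{\alpha}^{\top}(\boldsymbol{y}-\boldsymbol{\mu})}g^{(k+1)}\left(r^2+(\boldsymbol{y}-\boldsymbol{\mu})^{\top}\mathbf{\Omega}^{-1}(\boldsymbol{y}-\boldsymbol{\mu})\right)\mathrm{d}r,\quad \boldsymbol{y}\in\mathbb{R}^k,\qquad \boldsymbol{\alpha}^{\top}=\frac{\boldsymbol{\delta}^{\top}\mathbf{\Omega}^{-1}}{(1-\boldsymbol{\delta}^{\top}\mathbf{\Omega}^{-1}\boldsymbol{\delta})^{1/2}}.$$ $R$ is a nonnegative random variable with density $h(r)=\frac{2\pi^{(k+1)/2}r^k g^{(k+1)}(r^2)}{\Gamma((k+1)/2)}$,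 $r>0$. $R_0\sim\chi_{k+1}$ (i.e. $R_0\ge 0$ and $R_0^2$ is chi-square with $k+1$ degrees of freedom), so $\mathrm{E}[R_0]=\frac{\sqrt{2}\,\Gamma(k/2+1)}{\Gamma((k+1)/2)}$, $\mathrm{E}[R_0^2]=k+1$, $\mathrm{E}[R_0^3]=\frac{2\sqrt{2}\,\Gamma(k/2+2)}{\Gamma((k+1)/2)}$. Mardia measure of skewness: for a $k$-dimensional distribution $F$ with mean vector $\boldsymbol{\xi}$ and covariance matrix $\mathbf{\Delta}$, $\beta_{1,k}=\mathrm{E}\left[\left\{(\mathbf{X}-\boldsymbol{\xi})^{\top}\mathbf{\Delta}^{-1}(\mathbf{Y}-\boldsymbol{\xi})\right\}^3\right]$, where $\mathbf{X}$ and $\mathbf{Y}$ are independent random vectors with distribution $F$.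
   Formalization: The formal theorem takes δ* to be the square root of δᵀΩ⁻¹δ rather than δᵀΩ⁻¹δ as printed; with the printed definition the formula fails already for the univariate skew-normal distribution with 0<|δ|<1. *)

theory Defs
  imports "HOL-Probability.Probability"
begin

definition symmetric_positive_definite :: "real ^ 'n ^ 'n \<Rightarrow> bool" where
  "symmetric_positive_definite A \<longleftrightarrow>
     transpose A = A \<and> (\<forall>x. x \<noteq> 0 \<longrightarrow> 0 < x \<bullet> (A *v x))"

text \<open>
  Only the values of \<open>g\<close> on \<open>[0, \<infinity>)\<close> matter.  The type argument fixes the Euclidean space on which
  \<open>x \<mapsto> g (x \<bullet> x)\<close> is a density; below it is the \<open>(k+1)\<close>-dimensional space \<open>real \<times> (real ^ 'n)\<close>
  with \<open>k = CARD('n)\<close>, where \<open>(r, y) \<bullet> (r, y) = r\<^sup>2 + y \<bullet> y\<close>.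
\<close>

definition spherical_density_generator :: "'e::euclidean_space itself \<Rightarrow> (real \<Rightarrow> real) \<Rightarrow> bool" where
  "spherical_density_generator T g \<longleftrightarrow>
     (\<forall>u\<ge>0. 0 \<le> g u) \<and>
     (\<lambda>x::'e. g (x \<bullet> x)) \<in> borel_measurable borel \<and>
     (\<integral>\<^sup>+ x. ennreal (g ((x::'e) \<bullet> x)) \<partial>lborel) = 1"

definition skewness_vector :: "real ^ 'n ^ 'n \<Rightarrow> real ^ 'n \<Rightarrow> real ^ 'n" where
  "skewness_vector \<Omega> \<delta> =
     (1 / sqrt (1 - \<delta> \<bullet> (matrix_inv \<Omega> *v \<delta>))) *\<^sub>R (\<delta> v* matrix_inv \<Omega>)"

text \<open>
  The density takes values in \<open>ennreal\<close> because the inner integral may be infinite for \<open>y\<close> in a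
  null set.
\<close>

definition skew_elliptical_density ::
    "real ^ 'n \<Rightarrow> real ^ 'n ^ 'n \<Rightarrow> real ^ 'n \<Rightarrow> (real \<Rightarrow> real) \<Rightarrow> real ^ 'n \<Rightarrow> ennreal" where
  "skew_elliptical_density \<mu> \<Omega> \<delta> g y =
     ennreal (2 * det \<Omega> powr (- 1 / 2)) *
     (\<integral>\<^sup>+ r \<in> {.. skewness_vector \<Omega> \<delta> \<bullet> (y - \<mu>)}.
        ennreal (g (r\<^sup>2 + (y - \<mu>) \<bullet> (matrix_inv \<Omega> *v (y - \<mu>)))) \<partial>lborel)"

definition radial_density :: "nat \<Rightarrow> (real \<Rightarrow> real) \<Rightarrow> real \<Rightarrow> real" where
  "radial_density k g r =
     (if 0 < r
      then 2 * pi powr (real (k + 1) / 2) * r ^ k * g (r\<^sup>2) / Gamma (real (k + 1) / 2)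
      else 0)"

definition chi_square_density :: "nat \<Rightarrow> real \<Rightarrow> real" where
  "chi_square_density n x =
     (if 0 < x
      then x powr (real n / 2 - 1) * exp (- x / 2) / (2 powr (real n / 2) * Gamma (real n / 2))
      else 0)"

definition mean_vector :: "(real ^ 'n) measure \<Rightarrow> real ^ 'n" where
  "mean_vector F = (\<integral>x. x \<partial>F)"

definition covariance_matrix :: "(real ^ 'n) measure \<Rightarrow> real ^ 'n ^ 'n" where
  "covariance_matrix F =
     (\<chi> i j. \<integral>x. (x $ i - mean_vector F $ i) * (x $ j - mean_vector F $ j) \<partial>F)"

text \<open>
  \<open>F \<Otimes>\<^sub>M F\<close> is the joint law of two independent random vectors with distribution \<open>F\<close>.
\<close>

definition mardia_skewness :: "(real ^ 'n) measure \<Rightarrow> real" where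
  "mardia_skewness F =
     (\<integral>(x, y). ((x - mean_vector F) \<bullet>
                 (matrix_inv (covariance_matrix F) *v (y - mean_vector F))) ^ 3 \<partial>(F \<Otimes>\<^sub>M F))"

end

theory Submission
  imports Defs
begin

text \<open>
  The skew-elliptical law is an affine image of a spherical law conditioned on a half-space, and up
  to order three the latter depends on \<open>g\<close> only through \<open>a\<close>, \<open>b\<close> and \<open>c\<close>.

  Choose \<open>A\<close> whose columns are orthonormal for the form \<open>\<Omega>\<inverse>\<close>, such that \<open>\<delta>\<close> is a multiple of one
  of them, of index \<open>i0\<close> (\<open>skew_elliptical_whitening\<close>).  In the coordinates \<open>y = \<mu> + A z\<close> the density is
  the integral over \<open>r\<close> of \<open>2 g (r\<^sup>2 + |z|\<^sup>2)\<close> over \<open>s r \<le> d z\<^sub>0\<close>, where \<open>z\<^sub>0\<close> is the coordinate of index \<open>i0\<close>,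
  \<open>d = \<delta>s = sqrt (\<delta> \<bullet> \<Omega>\<inverse> \<delta>)\<close> and \<open>s = sqrt (1 - d\<^sup>2)\<close>.  An isometry of the \<open>(r, z\<^sub>0)\<close> plane turns this half-space into
  \<open>0 \<le> u\<close>.  So \<open>Y\<close> has the law of \<open>\<mu> + A Z\<close> with \<open>Z\<^sub>0 = d u + s v\<close> and \<open>Z\<^sub>i = w\<^sub>i\<close> otherwise, where
  \<open>(u, v, w)\<close> is spherical with generator \<open>g\<close>, conditioned on \<open>u > 0\<close> (\<open>skew_elliptical_law\<close>).

  A moment of a spherical law splits into a radial and an angular factor, and the Gaussian law has
  the same angular factor.  Hence the expectation of a homogeneous function of degree \<open>m\<close> is its
  Gaussian expectation times \<open>E[R\<^sup>m] / E[R\<^sub>0\<^sup>m]\<close> (\<open>spherical_moment_ratio\<close>).  Under the condition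
  \<open>u > 0\<close> this gives \<open>E u = a\<close>, \<open>E u\<^sup>2 = E v\<^sup>2 = b\<close>, \<open>E u\<^sup>3 = 2 c\<close> and \<open>E u v\<^sup>2 = c\<close>, and a
  monomial of odd degree in some coordinate other than \<open>u\<close> has mean zero by reflection.

  Therefore the centred \<open>Z\<close> has diagonal covariance, with entry \<open>b - a\<^sup>2 d\<^sup>2\<close> at \<open>i0\<close> and \<open>b\<close>
  elsewhere, and up to the order of the factors its only nonzero third moments are
  \<open>E Z\<^sub>0\<^sup>3 = 3 (c - a b) d + (2 a\<^sup>3 - c) d\<^sup>3\<close> and \<open>E Z\<^sub>0 Z\<^sub>i\<^sup>2 = (c - a b) d\<close>.
  The Mardia measure is affine invariant, and for uncorrelated coordinates it is the sum of the squared third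
  moments, each divided by the three variances (\<open>mardia_skewness_affine\<close>).  There is one term of the
  first kind and \<open>3 (k - 1)\<close> of the second (\<open>mardia_sum\<close>), which is the claim.
\<close>

section \<open>Integration of radial functions against homogeneous weights\<close>

lemma nn_integral_lborel_scale:
  fixes f :: "'e::euclidean_space \<Rightarrow> ennreal"
  assumes [measurable]: "f \<in> borel_measurable borel" and r: "0 < r"
  shows "(\<integral>\<^sup>+x. f x \<partial>lborel) = ennreal (r ^ DIM('e)) * (\<integral>\<^sup>+x. f (r *\<^sub>R x) \<partial>lborel)"
  using r by (subst lborel_affine[of r 0], simp)
    (simp add: nn_integral_density nn_integral_distr nn_integral_cmult)

lemma nn_integral_powr_0_upto:
  assumes "0 < \<kappa>" "0 \<le> t"
  shows "(\<integral>\<^sup>+s. ennreal (indicator {0<..} s * \<kappa> * s powr (\<kappa> - 1)) * indicator {..t} s \<partial>lborel) = ennreal (t powr \<kappa>)"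
proof -
  have "((\<lambda>x. \<kappa> * x powr (\<kappa> - 1)) has_integral \<kappa> * (t powr (\<kappa> - 1 + 1) / (\<kappa> - 1 + 1))) {0..t}"
    using assms by (intro has_integral_mult_right has_integral_powr_from_0) auto
  then have "(\<integral>\<^sup>+s. ennreal (indicator {0..t} s * (\<kappa> * s powr (\<kappa> - 1))) \<partial>lborel) = ennreal (t powr \<kappa>)"
    using assms by (subst nn_integral_has_integral_lebesgue) auto
  also have "(\<integral>\<^sup>+s. ennreal (indicator {0..t} s * (\<kappa> * s powr (\<kappa> - 1))) \<partial>lborel) =
    (\<integral>\<^sup>+s. ennreal (indicator {0<..} s * \<kappa> * s powr (\<kappa> - 1)) * indicator {..t} s \<partial>lborel)"
    by (intro nn_integral_cong) (auto simp: indicator_def)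
  finally show ?thesis by simp
qed

lemma borel_eq_sigma_sets_atMost: "sets borel = sigma_sets UNIV (range (atMost :: real \<Rightarrow> real set))"
  by (subst borel_eq_atMost) simp

text \<open>
  The integrand of a moment of degree \<open>m\<close>.  The bound by \<open>norm x ^ m\<close> makes its integral over the
  unit ball finite.  The exponent \<open>\<kappa>\<close> is half of the degree plus the dimension because the radial
  variable below is the squared norm.
\<close>

locale homogeneous_weight =
  fixes p :: "'e::euclidean_space \<Rightarrow> real" and m :: nat and \<kappa> :: real
  assumes measurable_weight[measurable]: "p \<in> borel_measurable borel"
    and weight_nonneg: "\<And>x. 0 \<le> p x"
    and weight_scale: "\<And>r x. 0 < r \<Longrightarrow> p (r *\<^sub>R x) = r ^ m * p x"
    and weight_le: "\<And>x. p x \<le> norm x ^ m"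
    and kappa_eq: "\<kappa> = real (DIM('e) + m) / 2"
begin

definition ball_mass :: ennreal where
  "ball_mass = (\<integral>\<^sup>+x. ennreal (p x) * indicator {..1} (x \<bullet> x) \<partial>lborel)"

lemma kappa_pos: "0 < \<kappa>"
  by (simp add: kappa_eq add_pos_nonneg)

lemma ball_mass_finite: "ball_mass < \<infinity>"
proof -
  have "ball_mass \<le> (\<integral>\<^sup>+x. indicator (cball 0 1 :: 'e set) x \<partial>lborel)"
    unfolding ball_mass_def
  proof (intro nn_integral_mono)
    fix x :: 'e
    show "ennreal (p x) * indicator {..1} (x \<bullet> x) \<le> indicator (cball 0 1) x"
    proof (cases "x \<bullet> x \<le> 1")
      case True
      then have "norm x \<le> 1" by (simp add: norm_eq_sqrt_inner)
      moreover have "p x \<le> 1"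
        using order_trans[OF weight_le power_le_one[OF norm_ge_zero \<open>norm x \<le> 1\<close>]] .
      ultimately show ?thesis using True by (simp add: ennreal_le_1)
    qed auto
  qed
  also have "\<dots> = emeasure lborel (cball 0 1 :: 'e set)" by simp
  also have "\<dots> < \<infinity>" by (intro emeasure_bounded_finite) simp
  finally show ?thesis .
qed

text \<open>
  Scaling by \<open>sqrt t\<close> maps the unit ball onto the sublevel set and multiplies the volume by
  \<open>t powr (DIM('e) / 2)\<close> and the weight by \<open>t powr (m / 2)\<close>.
\<close>

lemma sublevel_mass:
  assumes t: "0 < t"
  shows "(\<integral>\<^sup>+x. ennreal (p x) * indicator {..t} (x \<bullet> x) \<partial>lborel) = ball_mass * ennreal (t powr \<kappa>)"
proof -
  define r where "r = sqrt t"
  have r: "0 < r" "r * r = t" using t by (auto simp: r_def)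
  have "(\<integral>\<^sup>+x. ennreal (p x) * indicator {..t} (x \<bullet> x) \<partial>lborel) =
      ennreal (r ^ DIM('e)) *
      (\<integral>\<^sup>+x. ennreal (p (r *\<^sub>R x)) * indicator {..t} ((r *\<^sub>R x) \<bullet> (r *\<^sub>R x)) \<partial>lborel)"
    by (rule nn_integral_lborel_scale) (use r in auto)
  also have "\<dots> = ennreal (r ^ DIM('e)) *
      (\<integral>\<^sup>+x. ennreal (r ^ m) * (ennreal (p x) * indicator {..1} (x \<bullet> x)) \<partial>lborel)"
  proof (rule arg_cong2[where f="(*)"], rule refl, rule nn_integral_cong)
    fix x :: 'e
    have "((r *\<^sub>R x) \<bullet> (r *\<^sub>R x) \<le> t) = (x \<bullet> x \<le> 1)"
      using r t by (simp flip: mult.assoc)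
    then show "ennreal (p (r *\<^sub>R x)) * indicator {..t} ((r *\<^sub>R x) \<bullet> (r *\<^sub>R x)) =
        ennreal (r ^ m) * (ennreal (p x) * indicator {..1} (x \<bullet> x))"
      using r by (simp add: weight_scale weight_nonneg ennreal_mult indicator_def)
  qed
  also have "\<dots> = ennreal (r ^ DIM('e)) * (ennreal (r ^ m) * ball_mass)"
    unfolding ball_mass_def by (subst nn_integral_cmult) auto
  also have "\<dots> = ennreal (r ^ (DIM('e) + m)) * ball_mass"
    using r by (simp add: power_add ennreal_mult mult.assoc)
  also have "r ^ (DIM('e) + m) = (t powr (1 / 2)) powr real (DIM('e) + m)"
    using t r(1) by (simp only: r_def powr_half_sqrt less_imp_le powr_realpow)
  also have "\<dots> = t powr \<kappa>"
    by (simp only: powr_powr kappa_eq) simp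
  finally show ?thesis by (simp add: mult.commute)
qed

text \<open>
  This replaces polar coordinates.  The pushforward under the squared norm is determined by its
  masses on half-lines, and these are powers of the endpoint because the weight is homogeneous.
\<close>

lemma distr_inner_self:
  "distr (density lborel p) borel (\<lambda>x. x \<bullet> x) =
   density lborel (\<lambda>t. ball_mass * ennreal (indicator {0<..} t * \<kappa> * t powr (\<kappa> - 1)))"
  (is "?L = ?R")
proof (rule measure_eqI_generator_eq[where E="range atMost" and A="\<lambda>i. {..real i}" and \<Omega>=UNIV])
  show "Int_stable (range (atMost :: real \<Rightarrow> _))"
    by (auto simp: Int_stable_def)
  have L: "emeasure ?L {..t} = (\<integral>\<^sup>+x. ennreal (p x) * indicator {..t} (x \<bullet> x) \<partial>lborel)" for t
  proof -
    have "emeasure ?L {..t} = (\<integral>\<^sup>+s. indicator {..t} s \<partial>?L)"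
      by (rule nn_integral_indicator[symmetric]) simp
    also have "\<dots> = (\<integral>\<^sup>+x. indicator {..t} (x \<bullet> x) \<partial>density lborel p)"
      by (rule nn_integral_distr) auto
    also have "\<dots> = (\<integral>\<^sup>+x. ennreal (p x) * indicator {..t} (x \<bullet> x) \<partial>lborel)"
      by (rule nn_integral_density) auto
    finally show ?thesis .
  qed
  have R: "emeasure ?R {..t} = ball_mass * (\<integral>\<^sup>+s. ennreal (indicator {0<..} s * \<kappa> * s powr (\<kappa> - 1)) * indicator {..t} s \<partial>lborel)" for t
  proof -
    have "emeasure ?R {..t} = (\<integral>\<^sup>+s. ball_mass * ennreal (indicator {0<..} s * \<kappa> * s powr (\<kappa> - 1)) * indicator {..t} s \<partial>lborel)"
      by (rule emeasure_density) auto
    then show ?thesis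
      by (simp only: mult.assoc[of ball_mass] nn_integral_cmult) (rule nn_integral_cmult, measurable)
  qed
  show "emeasure ?L X = emeasure ?R X" if X_in: "X \<in> range atMost" for X :: "real set"
  proof -
    obtain t where X: "X = {..t}" using X_in by blast
    show ?thesis
    proof (cases "0 < t")
      case True
      show ?thesis
        unfolding X L R sublevel_mass[OF True] nn_integral_powr_0_upto[OF kappa_pos less_imp_le[OF True]] by (rule refl)
    next
      case False
      have "(\<integral>\<^sup>+x. ennreal (p x) * indicator {..t} (x \<bullet> x) \<partial>lborel) = (\<integral>\<^sup>+x. 0 \<partial>(lborel :: 'e measure))"
      proof (rule nn_integral_cong_AE)
        have "AE x in lborel. x \<noteq> (0::'e)"
          by (rule AE_lborel_singleton)
        then show "AE x in lborel. ennreal (p x) * indicator {..t} (x \<bullet> x) = 0"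
        proof eventually_elim
          case (elim x)
          from elim have "0 < x \<bullet> x" by simp
          then have "t < x \<bullet> x" using False by linarith
          then show ?case by simp
        qed
      qed
      moreover have "(\<integral>\<^sup>+s. ennreal (indicator {0<..} s * \<kappa> * s powr (\<kappa> - 1)) * indicator {..t} s \<partial>lborel) = (\<integral>\<^sup>+s. 0 \<partial>(lborel :: real measure))"
        using False by (intro nn_integral_cong) (auto simp: indicator_def)
      ultimately show ?thesis unfolding X L R by simp
    qed
  qed
  show "sets ?L = sigma_sets UNIV (range atMost)" "sets ?R = sigma_sets UNIV (range atMost)"
    by (simp_all add: borel_eq_sigma_sets_atMost)
  show "(\<Union>i. {..real i}) = UNIV"
    by (auto simp: real_arch_simple)
  show "emeasure ?L {..real i} \<noteq> \<infinity>" for i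
  proof -
    have "emeasure ?L {..real i} \<le> emeasure ?L {..real (Suc i)}"
      by (intro emeasure_mono) auto
    also have "\<dots> < \<infinity>"
      unfolding L using ball_mass_finite
      by (simp only: sublevel_mass of_nat_0_less_iff zero_less_Suc infinity_ennreal_def) (intro ennreal_mult_less_top[THEN iffD2] disjI2 conjI, auto)
    finally show ?thesis by simp
  qed
qed (simp_all add: image_subset_iff)

text \<open>
  The weight enters only through the constant \<open>ball_mass\<close>, so two radial functions can be compared
  without knowing the angular integral.
\<close>

lemma nn_integral_radial:
  assumes [measurable]: "\<phi> \<in> borel_measurable borel"
  shows "(\<integral>\<^sup>+x. ennreal (p x) * \<phi> (x \<bullet> x) \<partial>lborel) =
    ball_mass * ennreal \<kappa> * (\<integral>\<^sup>+t. ennreal (indicator {0<..} t * t powr (\<kappa> - 1)) * \<phi> t \<partial>lborel)"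
proof -
  have "(\<integral>\<^sup>+x. ennreal (p x) * \<phi> (x \<bullet> x) \<partial>lborel) = (\<integral>\<^sup>+x. \<phi> (x \<bullet> x) \<partial>density lborel p)"
    by (simp add: nn_integral_density)
  also have "\<dots> = (\<integral>\<^sup>+t. \<phi> t \<partial>distr (density lborel p) borel (\<lambda>x. x \<bullet> x))"
    by (subst nn_integral_distr) auto
  also have "\<dots> = (\<integral>\<^sup>+t. ball_mass * ennreal \<kappa> * (ennreal (indicator {0<..} t * t powr (\<kappa> - 1)) * \<phi> t) \<partial>lborel)"
    using kappa_pos unfolding distr_inner_self
    by (subst nn_integral_density) (auto intro!: nn_integral_cong simp: ennreal_mult' indicator_def mult.assoc)
  also have "\<dots> = ball_mass * ennreal \<kappa> * (\<integral>\<^sup>+t. ennreal (indicator {0<..} t * t powr (\<kappa> - 1)) * \<phi> t \<partial>lborel)"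
    by (subst nn_integral_cmult) auto
  finally show ?thesis .
qed

end

section \<open>Comparison with the Gaussian density\<close>

text \<open>
  The radial factor of the integral of \<open>\<phi> (x \<bullet> x)\<close> against a homogeneous weight, in the variable
  \<open>t = x \<bullet> x\<close>.
\<close>

definition radial_integral :: "real \<Rightarrow> (real \<Rightarrow> ennreal) \<Rightarrow> ennreal" where
  "radial_integral \<kappa> \<phi> = (\<integral>\<^sup>+t. ennreal (indicator {0<..} t * t powr (\<kappa> - 1)) * \<phi> t \<partial>lborel)"

lemma radial_integral_gaussian:
  assumes "0 < \<kappa>"
  shows "radial_integral \<kappa> (\<lambda>t. ennreal (exp (- t / 2))) = ennreal (2 powr \<kappa> * Gamma \<kappa>)"
proof -
  have "radial_integral \<kappa> (\<lambda>t. ennreal (exp (- t / 2))) =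
    ennreal 2 * (\<integral>\<^sup>+t. ennreal (indicator {0<..} (2 * t) * (2 * t) powr (\<kappa> - 1)) * ennreal (exp (- (2 * t) / 2)) \<partial>lborel)"
    unfolding radial_integral_def
    by (subst nn_integral_real_affine[where c=2 and t=0]) auto
  also have "\<dots> = ennreal 2 * (\<integral>\<^sup>+t. ennreal (2 powr (\<kappa> - 1)) * ennreal (indicator {0..} t * t powr (\<kappa> - 1) / exp t) \<partial>lborel)"
    by (rule arg_cong2[where f="(*)"], rule refl, rule nn_integral_cong)
      (auto simp: indicator_def powr_mult exp_minus field_simps simp flip: ennreal_mult')
  also have "\<dots> = ennreal 2 * (ennreal (2 powr (\<kappa> - 1)) * ennreal (Gamma \<kappa>))"
    using assms by (subst nn_integral_cmult) (auto simp: Gamma_conv_nn_integral_real)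
  also have "\<dots> = ennreal (2 * 2 powr (\<kappa> - 1) * Gamma \<kappa>)"
    using assms Gamma_real_pos[of \<kappa>] by (simp add: ennreal_mult mult.assoc)
  also have "2 * 2 powr (\<kappa> - 1) = (2 powr \<kappa> :: real)"
    by (simp add: powr_diff)
  finally show ?thesis .
qed

text \<open>
  Both integrals over the space contain the angular constant \<open>ball_mass * \<kappa>\<close>.  Multiplying each by
  the radial factor of the other eliminates it, and remains meaningful when the constant vanishes
  or a radial factor is infinite.
\<close>

lemma (in homogeneous_weight) gaussian_comparison:
  assumes [measurable]: "\<phi> \<in> borel_measurable borel"
  shows "(\<integral>\<^sup>+x. ennreal (p x) * \<phi> (x \<bullet> x) \<partial>lborel) * ennreal (2 powr \<kappa> * Gamma \<kappa>) =
    (\<integral>\<^sup>+x. ennreal (p x) * ennreal (exp (- (x \<bullet> x) / 2)) \<partial>lborel) * radial_integral \<kappa> \<phi>"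
proof -
  have "(\<integral>\<^sup>+x. ennreal (p x) * ennreal (exp (- (x \<bullet> x) / 2)) \<partial>lborel) = ball_mass * ennreal \<kappa> * radial_integral \<kappa> (\<lambda>t. ennreal (exp (- t / 2)))"
    unfolding radial_integral_def by (rule nn_integral_radial) measurable
  then show ?thesis
    using nn_integral_radial[OF assms]
    by (simp only: radial_integral_gaussian[OF kappa_pos]) (simp add: radial_integral_def mult_ac)
qed

text \<open>
  The positive part \<open>u\<^sub>+ ^ i\<close>, with value \<open>0\<close> at the origin also for \<open>i = 0\<close>.  It is at once a
  homogeneous weight on the line, which turns integrals in \<open>r\<close> into integrals in \<open>t = r\<^sup>2\<close>, and the
  half-space factor of the moments below.
\<close>

definition half_power :: "nat \<Rightarrow> real \<Rightarrow> real" where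
  "half_power i u = (if 0 < u then u ^ i else 0)"

interpretation half_power: homogeneous_weight "half_power i" i "real (i + 1) / 2" for i
proof
  show "half_power i \<in> borel_measurable borel"
    unfolding half_power_def[abs_def] by measurable
qed (auto simp: half_power_def power_mult_distrib zero_less_mult_iff)

lemma half_power_ball_mass: "half_power.ball_mass i * ennreal (real (i + 1) / 2) = ennreal (1 / 2)"
proof -
  have "half_power.ball_mass i * ennreal (real (i + 1)) =
     (\<integral>\<^sup>+u. ennreal (half_power i u) * indicator {..1} (u \<bullet> u) * ennreal (real (i + 1)) \<partial>lborel)"
    unfolding half_power.ball_mass_def by (subst nn_integral_multc) (auto simp del: of_nat_add)
  also have "\<dots> = (\<integral>\<^sup>+s. ennreal (indicator {0<..} s * real (i + 1) * s powr (real (i + 1) - 1)) * indicator {..1} s \<partial>lborel)"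
  proof (rule nn_integral_cong)
    fix u :: real
    have "u * u \<le> 1 \<longleftrightarrow> u \<le> 1" if "0 < u"
      using that mult_le_one[of u u] mult_strict_mono[of 1 u 1 u] by (cases "u \<le> 1") auto
    moreover define q where "q = real (i + 1)"
    moreover have "u powr (q - 1) = u ^ i" if "0 < u"
      using that by (simp add: q_def powr_realpow)
    ultimately show "ennreal (half_power i u) * indicator {..1} (u \<bullet> u) * ennreal (real (i + 1)) =
      ennreal (indicator {0<..} u * real (i + 1) * u powr (real (i + 1) - 1)) * indicator {..1} u"
      unfolding q_def[symmetric]
      by (auto simp: half_power_def indicator_def q_def ennreal_mult'' mult.commute simp del: of_nat_add of_nat_Suc)
  qed
  also have "\<dots> = 1"
    by (subst nn_integral_powr_0_upto) auto
  finally have "half_power.ball_mass i * ennreal (real (i + 1)) * ennreal (1 / 2) = ennreal (1 / 2)"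
    by simp
  moreover have "ennreal (real (i + 1) / 2) = ennreal (real (i + 1)) * ennreal (1 / 2)"
    by (subst ennreal_mult[symmetric]) auto
  ultimately show ?thesis
    by (simp only: mult.assoc)
qed

lemma nn_integral_half_power:
  assumes [measurable]: "\<phi> \<in> borel_measurable borel"
  shows "(\<integral>\<^sup>+u. ennreal (half_power i u) * \<phi> (u\<^sup>2) \<partial>lborel) =
    ennreal (1 / 2) * radial_integral (real (i + 1) / 2) \<phi>"
  using half_power.nn_integral_radial[OF assms, of i]
  by (simp only: half_power_ball_mass radial_integral_def inner_real_def power2_eq_square)

lemma nn_integral_half_power_normal:
  "(\<integral>\<^sup>+u. ennreal (half_power i u * std_normal_density u) \<partial>lborel) =
    ennreal (2 powr (real (i + 1) / 2) * Gamma (real (i + 1) / 2) / (2 * sqrt (2 * pi)))"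
proof -
  let ?\<kappa> = "real (i + 1) / 2"
  have "(\<integral>\<^sup>+u. ennreal (half_power i u * std_normal_density u) \<partial>lborel) =
    (\<integral>\<^sup>+u. ennreal (1 / sqrt (2 * pi)) * (ennreal (half_power i u) * ennreal (exp (- u\<^sup>2 / 2))) \<partial>lborel)"
    by (intro nn_integral_cong) (simp add: std_normal_density_def half_power_def flip: ennreal_mult)
  also have "\<dots> = ennreal (1 / sqrt (2 * pi)) * (ennreal (1 / 2) * ennreal (2 powr ?\<kappa> * Gamma ?\<kappa>))"
    by (subst nn_integral_cmult, measurable, subst nn_integral_half_power[of "\<lambda>t. ennreal (exp (- t / 2))"],
       measurable, subst radial_integral_gaussian) auto
  also have "\<dots> = ennreal (2 powr ?\<kappa> * Gamma ?\<kappa> / (2 * sqrt (2 * pi)))"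
  proof -
    define G where "G = 2 powr ?\<kappa> * Gamma ?\<kappa>"
    have "0 \<le> G" using Gamma_real_pos[of ?\<kappa>] by (simp add: G_def)
    have e: "ennreal (x * (y * z)) = ennreal x * (ennreal y * ennreal z)"
      if "0 \<le> x" "0 \<le> y" "0 \<le> z" for x y z
      using that by (simp add: ennreal_mult)
    have "ennreal (1 / sqrt (2 * pi)) * (ennreal (1 / 2) * ennreal G) = ennreal (1 / sqrt (2 * pi) * (1 / 2 * G))"
      using \<open>0 \<le> G\<close> by (intro e[symmetric]) auto
    then show ?thesis unfolding G_def[symmetric] by (simp add: mult_ac)
  qed
  finally show ?thesis .
qed

lemma Gamma_three_halves: "Gamma (3 / 2 :: real) = sqrt pi / 2"
proof -
  have "(1 / 2 :: real) \<notin> \<int>\<^sub>\<le>\<^sub>0" by (auto elim!: nonpos_Ints_cases)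
  then show ?thesis
    using Gamma_plus1[of "1 / 2 :: real"] by (simp add: Gamma_one_half_real)
qed

lemma half_normal_moments:
  "(\<integral>\<^sup>+u. ennreal (half_power 0 u * std_normal_density u) \<partial>lborel) = ennreal (1 / 2)"
  "(\<integral>\<^sup>+u. ennreal (half_power 1 u * std_normal_density u) \<partial>lborel) = ennreal (1 / sqrt (2 * pi))"
  "(\<integral>\<^sup>+u. ennreal (half_power 2 u * std_normal_density u) \<partial>lborel) = ennreal (1 / 2)"
  "(\<integral>\<^sup>+u. ennreal (half_power 3 u * std_normal_density u) \<partial>lborel) = ennreal (2 / sqrt (2 * pi))"
proof -
  have 1: "(2::real) powr (3 / 2) = 2 * sqrt 2"
    using powr_add[of 2 1 "1 / 2 :: real"] by (simp add: powr_half_sqrt)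
  have 2: "(2::real) powr 2 = 4" using powr_realpow[of 2 2] by simp
  have 3: "Gamma (2::real) = 1" using Gamma_fact[of 1, where 'a=real] by simp
  show "(\<integral>\<^sup>+u. ennreal (half_power 0 u * std_normal_density u) \<partial>lborel) = ennreal (1 / 2)"
    by (subst nn_integral_half_power_normal) (simp add: powr_half_sqrt Gamma_one_half_real real_sqrt_mult)
  show "(\<integral>\<^sup>+u. ennreal (half_power 1 u * std_normal_density u) \<partial>lborel) = ennreal (1 / sqrt (2 * pi))"
    by (subst nn_integral_half_power_normal) simp
  show "(\<integral>\<^sup>+u. ennreal (half_power 2 u * std_normal_density u) \<partial>lborel) = ennreal (1 / 2)"
    by (subst nn_integral_half_power_normal) (simp add: 1 Gamma_three_halves real_sqrt_mult)
  show "(\<integral>\<^sup>+u. ennreal (half_power 3 u * std_normal_density u) \<partial>lborel) = ennreal (2 / sqrt (2 * pi))"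
    by (subst nn_integral_half_power_normal) (simp add: 2 3 )
qed

definition gauss :: "'e::euclidean_space \<Rightarrow> real" where
  "gauss x = (2 * pi) powr (- real DIM('e) / 2) * exp (- (x \<bullet> x) / 2)"

lemma prod_std_normal_density:
  "(\<Prod>b\<in>Basis. std_normal_density (x \<bullet> b)) = gauss (x :: 'e::euclidean_space)"
proof -
  have "(\<Prod>b\<in>Basis. std_normal_density (x \<bullet> b)) =
     (1 / sqrt (2 * pi)) ^ DIM('e) * exp (\<Sum>b\<in>Basis. - (x \<bullet> b)\<^sup>2 / 2)"
    by (simp add: std_normal_density_def prod.distrib exp_sum prod_dividef power_divide)
  also have "(\<Sum>b\<in>Basis. - (x \<bullet> b)\<^sup>2 / 2) = - (x \<bullet> x) / 2"
    by (subst (2) euclidean_inner) (simp add: power2_eq_square sum_divide_distrib sum_negf)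
  also have "(1 / sqrt (2 * pi)) ^ DIM('e) = ((2 * pi) powr (- 1 / 2)) powr real DIM('e)"
    by (subst powr_realpow) (auto simp: powr_minus_divide powr_half_sqrt)
  also have "\<dots> = (2 * pi) powr (- real DIM('e) / 2)"
    by (simp add: powr_powr)
  finally show ?thesis by (simp add: gauss_def)
qed

lemma nn_integral_std_normal: "(\<integral>\<^sup>+v. ennreal (std_normal_density v) \<partial>lborel) = 1"
  using prob_space.emeasure_space_1[OF prob_space_normal_density[of 1 0]] by (simp add: emeasure_density)

text \<open>
  Independence of two coordinates of a Gaussian vector; the remaining coordinates integrate to one.
\<close>

lemma nn_integral_gauss_pair:
  fixes b0 b1 :: "'e::euclidean_space" and \<alpha> \<beta> :: "real \<Rightarrow> real"
  assumes [measurable]: "\<alpha> \<in> borel_measurable borel" "\<beta> \<in> borel_measurable borel"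
    and nonneg: "\<And>u. 0 \<le> \<alpha> u" "\<And>u. 0 \<le> \<beta> u"
    and b: "b0 \<in> Basis" "b1 \<in> Basis" "b0 \<noteq> b1"
  shows "(\<integral>\<^sup>+x. ennreal (\<alpha> (x \<bullet> b0) * \<beta> (x \<bullet> b1)) * ennreal (gauss x) \<partial>lborel) =
    (\<integral>\<^sup>+u. ennreal (\<alpha> u * std_normal_density u) \<partial>lborel) *
    (\<integral>\<^sup>+v. ennreal (\<beta> v * std_normal_density v) \<partial>lborel)"
proof -
  define w :: "'e \<Rightarrow> real \<Rightarrow> real" where
    "w b = (if b = b0 then \<alpha> else if b = b1 then \<beta> else (\<lambda>_. 1))" for b
  have w: "w b \<in> borel_measurable borel" "0 \<le> w b u" for b u
    using nonneg by (auto simp: w_def)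
  have split: "(\<Prod>b\<in>Basis. F b) = F b0 * (F b1 * (\<Prod>b\<in>Basis - {b0} - {b1}. F b))"
    for F :: "'e \<Rightarrow> 'z::comm_monoid_mult"
    using b by (simp add: prod.remove[of Basis b0] prod.remove[of "Basis - {b0}" b1])
  have "\<alpha> (x \<bullet> b0) * \<beta> (x \<bullet> b1) * gauss x = (\<Prod>b\<in>Basis. w b (x \<bullet> b) * std_normal_density (x \<bullet> b))" for x :: 'e
    unfolding prod.distrib prod_std_normal_density using b by (subst split) (auto simp: w_def)
  then have "(\<integral>\<^sup>+x. ennreal (\<alpha> (x \<bullet> b0) * \<beta> (x \<bullet> b1)) * ennreal (gauss x) \<partial>lborel) =
    (\<integral>\<^sup>+x. (\<Prod>b\<in>Basis. ennreal (w b (x \<bullet> b) * std_normal_density (x \<bullet> b))) \<partial>(lborel :: 'e measure))"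
    using w nonneg by (auto simp: prod_ennreal gauss_def simp flip: ennreal_mult' intro!: nn_integral_cong)
  also have "\<dots> = (\<Prod>b\<in>Basis. (\<integral>\<^sup>+u. ennreal (w b u * std_normal_density u) \<partial>lborel))"
    by (rule nn_integral_lborel_prod[where f="\<lambda>b u. ennreal (w b u * std_normal_density u)"]) (use w in auto)
  also have "\<dots> = (\<integral>\<^sup>+u. ennreal (\<alpha> u * std_normal_density u) \<partial>lborel) *
    (\<integral>\<^sup>+v. ennreal (\<beta> v * std_normal_density v) \<partial>lborel)"
    using b by (subst split) (auto simp: w_def nn_integral_std_normal)
  finally show ?thesis .
qed

section \<open>Moments of the radial variables\<close>

text \<open>
  The substitution \<open>t = r\<^sup>2\<close> puts the moments of \<open>R\<close> in the form in which the generator occurs in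
  \<open>gaussian_comparison\<close>.  Only the values of \<open>g\<close> on the nonnegative half-line are controlled, hence
  the truncation \<open>max 0 t\<close>.
\<close>

lemma nn_integral_radial_variable:
  assumes R: "distributed N lborel R (\<lambda>r. ennreal (radial_density k g r))"
    and R_nonneg: "\<And>\<omega>. \<omega> \<in> space N \<Longrightarrow> 0 \<le> R \<omega>"
    and g: "(\<lambda>t. ennreal (g (max 0 t))) \<in> borel_measurable borel" "\<And>t. 0 \<le> t \<Longrightarrow> 0 \<le> g t"
  shows "(\<integral>\<^sup>+\<omega>. ennreal (R \<omega> ^ m) \<partial>N) =
    ennreal (pi powr (real (k + 1) / 2) / Gamma (real (k + 1) / 2)) *
    radial_integral (real (k + 1 + m) / 2) (\<lambda>t. ennreal (g (max 0 t)))"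
proof -
  define C where "C = pi powr (real (k + 1) / 2) / Gamma (real (k + 1) / 2)"
  have C: "0 \<le> C" using Gamma_real_pos[of "real (k + 1) / 2"] by (simp add: C_def)
  have "(\<integral>\<^sup>+\<omega>. ennreal (R \<omega> ^ m) \<partial>N) = (\<integral>\<^sup>+r. ennreal (radial_density k g r) * ennreal (r ^ m) \<partial>lborel)"
    by (rule distributed_nn_integral[OF R, symmetric]) simp
  also have "\<dots> = (\<integral>\<^sup>+r. ennreal (2 * C) * (ennreal (half_power (k + m) r) * ennreal (g (max 0 (r\<^sup>2)))) \<partial>lborel)"
  proof (rule nn_integral_cong)
    fix r :: real
    have "radial_density k g r = 2 * C * r ^ k * g (r\<^sup>2)" if "0 < r"
      using that by (simp add: radial_density_def C_def)
    then show "ennreal (radial_density k g r) * ennreal (r ^ m) =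
      ennreal (2 * C) * (ennreal (half_power (k + m) r) * ennreal (g (max 0 (r\<^sup>2))))"
      using C g(2)[of "r\<^sup>2"] by (cases "0 < r")
        (auto simp: half_power_def radial_density_def power_add mult_ac simp flip: ennreal_mult')
  qed
  also have "\<dots> = ennreal (2 * C) * (\<integral>\<^sup>+r. ennreal (half_power (k + m) r) * ennreal (g (max 0 (r\<^sup>2))) \<partial>lborel)"
    by (rule nn_integral_cmult) (use measurable_compose[OF _ g(1)] in measurable)
  also have "\<dots> = ennreal (2 * C) * (ennreal (1 / 2) * radial_integral (real (k + m + 1) / 2) (\<lambda>t. ennreal (g (max 0 t))))"
    by (subst nn_integral_half_power[OF g(1)]) (rule refl)
  also have "\<dots> = ennreal C * radial_integral (real (k + m + 1) / 2) (\<lambda>t. ennreal (g (max 0 t)))"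
  proof -
    have "ennreal (2 * C) * ennreal (1 / 2) = ennreal C"
      using C by (subst ennreal_mult[symmetric]) auto
    then show ?thesis by (simp only: mult.assoc[symmetric])
  qed
  finally show ?thesis by (simp add: C_def add_ac)
qed

lemma nn_integral_chi_variable:
  assumes R0: "distributed N0 lborel (\<lambda>\<omega>. (R0 \<omega>)\<^sup>2) (\<lambda>x. ennreal (chi_square_density n x))"
    and R0_nonneg: "\<And>\<omega>. \<omega> \<in> space N0 \<Longrightarrow> 0 \<le> R0 \<omega>"
    and n: "0 < n"
  shows "(\<integral>\<^sup>+\<omega>. ennreal (R0 \<omega> ^ m) \<partial>N0) =
    ennreal (2 powr (real (n + m) / 2) * Gamma (real (n + m) / 2) / (2 powr (real n / 2) * Gamma (real n / 2)))"
proof -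
  let ?\<kappa> = "real (n + m) / 2"
  define D where "D = 2 powr (real n / 2) * Gamma (real n / 2)"
  have D: "0 < D" using Gamma_real_pos[of "real n / 2"] n by (simp add: D_def)
  have "(\<integral>\<^sup>+\<omega>. ennreal (R0 \<omega> ^ m) \<partial>N0) = (\<integral>\<^sup>+\<omega>. ennreal (sqrt ((R0 \<omega>)\<^sup>2) ^ m) \<partial>N0)"
    using R0_nonneg by (intro nn_integral_cong) auto
  also have "\<dots> = (\<integral>\<^sup>+x. ennreal (chi_square_density n x) * ennreal (sqrt x ^ m) \<partial>lborel)"
    by (rule distributed_nn_integral[OF R0, symmetric]) simp
  also have "\<dots> = (\<integral>\<^sup>+x. ennreal (1 / D) * (ennreal (indicator {0<..} x * x powr (?\<kappa> - 1)) * ennreal (exp (- x / 2))) \<partial>lborel)"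
  proof (rule nn_integral_cong)
    fix x :: real
    show "ennreal (chi_square_density n x) * ennreal (sqrt x ^ m) =
      ennreal (1 / D) * (ennreal (indicator {0<..} x * x powr (?\<kappa> - 1)) * ennreal (exp (- x / 2)))"
    proof (cases "0 < x")
      case True
      then have "sqrt x ^ m = x powr (real m / 2)"
        by (subst powr_realpow[symmetric]) (auto simp: powr_powr simp flip: powr_half_sqrt)
      then have "x powr (real n / 2 - 1) * sqrt x ^ m = x powr (?\<kappa> - 1)"
        by (simp add: powr_add[symmetric] add_divide_distrib algebra_simps)
      then have "chi_square_density n x * sqrt x ^ m = 1 / D * (x powr (?\<kappa> - 1) * exp (- x / 2))"
        using True by (simp add: chi_square_density_def D_def mult_ac)
      then show ?thesis using True D by (simp flip: ennreal_mult ennreal_mult' ennreal_mult'')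
    qed (simp add: chi_square_density_def)
  qed
  also have "\<dots> = ennreal (1 / D) * radial_integral ?\<kappa> (\<lambda>t. ennreal (exp (- t / 2)))"
    unfolding radial_integral_def by (rule nn_integral_cmult) measurable
  also have "\<dots> = ennreal (2 powr ?\<kappa> * Gamma ?\<kappa> / D)"
    using n D by (subst radial_integral_gaussian) (auto simp flip: ennreal_mult')
  finally show ?thesis by (simp only: D_def)
qed

context homogeneous_weight begin

lemma nn_integral_gauss_finite: "(\<integral>\<^sup>+x. ennreal (p x) * ennreal (gauss x) \<partial>lborel) < \<infinity>"
proof -
  have "(\<integral>\<^sup>+x. ennreal (p x) * ennreal (gauss x) \<partial>lborel) =
    (\<integral>\<^sup>+x. ennreal ((2 * pi) powr (- real DIM('e) / 2)) * (ennreal (p x) * ennreal (exp (- (x \<bullet> x) / 2))) \<partial>lborel)"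
    by (intro nn_integral_cong) (simp add: gauss_def mult_ac ennreal_mult')
  also have "\<dots> = ennreal ((2 * pi) powr (- real DIM('e) / 2)) * (ball_mass * ennreal \<kappa> * radial_integral \<kappa> (\<lambda>t. ennreal (exp (- t / 2))))"
    unfolding radial_integral_def
    by (subst nn_integral_cmult, measurable, subst nn_integral_radial[symmetric], measurable)
  also have "\<dots> < \<infinity>"
    using ball_mass_finite unfolding radial_integral_gaussian[OF kappa_pos] by (simp add: ennreal_mult_less_top)
  finally show ?thesis .
qed

text \<open>
  The statement avoids division, so that it also holds when a moment of \<open>R\<close> is infinite.  This is
  used below to deduce finiteness of \<open>E[R\<^sup>3]\<close> from the third moments of \<open>Y\<close>.
\<close>

lemma spherical_moment_ratio:
  assumes R: "distributed N lborel R (\<lambda>r. ennreal (radial_density k g r))"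
    and R_nonneg: "\<And>\<omega>. \<omega> \<in> space N \<Longrightarrow> 0 \<le> R \<omega>"
    and R0: "distributed N0 lborel (\<lambda>\<omega>. (R0 \<omega>)\<^sup>2) (\<lambda>x. ennreal (chi_square_density (k + 1) x))"
    and R0_nonneg: "\<And>\<omega>. \<omega> \<in> space N0 \<Longrightarrow> 0 \<le> R0 \<omega>"
    and k: "k + 1 = DIM('e)"
    and g: "(\<lambda>t. ennreal (g (max 0 t))) \<in> borel_measurable borel" "\<And>t. 0 \<le> t \<Longrightarrow> 0 \<le> g t"
  shows "(\<integral>\<^sup>+x. ennreal (p x) * ennreal (g (x \<bullet> x)) \<partial>lborel) * (\<integral>\<^sup>+\<omega>. ennreal (R0 \<omega> ^ m) \<partial>N0) =
    (\<integral>\<^sup>+x. ennreal (p x) * ennreal (gauss x) \<partial>lborel) * (\<integral>\<^sup>+\<omega>. ennreal (R \<omega> ^ m) \<partial>N)"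
proof -
  let ?X = "\<integral>\<^sup>+x. ennreal (p x) * ennreal (g (x \<bullet> x)) \<partial>lborel"
  let ?Y = "\<integral>\<^sup>+x. ennreal (p x) * ennreal (exp (- (x \<bullet> x) / 2)) \<partial>lborel"
  let ?K = "radial_integral \<kappa> (\<lambda>t. ennreal (g (max 0 t)))"
  define G where "G = 2 powr \<kappa> * Gamma \<kappa>"
  define h where "h = real DIM('e) / 2"
  define A where "A = Gamma h"
  have pos: "0 < G" "0 < A" using kappa_pos by (auto simp: G_def A_def h_def)
  have X: "?X * ennreal G = ?Y * ?K"
    using gaussian_comparison[OF g(1)] by (simp add: G_def)
  have r0: "(\<integral>\<^sup>+\<omega>. ennreal (R0 \<omega> ^ m) \<partial>N0) = ennreal (1 / (2 powr h * A)) * ennreal G"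
  proof -
    have k0: "0 < k + 1" by simp
    have "(\<integral>\<^sup>+\<omega>. ennreal (R0 \<omega> ^ m) \<partial>N0) = ennreal (G / (2 powr h * A))"
      using nn_integral_chi_variable[OF R0 R0_nonneg k0, of m]
      by (simp only: k G_def kappa_eq A_def h_def)
    then show ?thesis using pos by (simp flip: ennreal_mult')
  qed
  have r: "(\<integral>\<^sup>+\<omega>. ennreal (R \<omega> ^ m) \<partial>N) = ennreal (pi powr h / A) * ?K"
    using nn_integral_radial_variable[OF R R_nonneg g, of m] by (simp only: h_def A_def kappa_eq k)
  have y: "(\<integral>\<^sup>+x. ennreal (p x) * ennreal (gauss x) \<partial>lborel) = ennreal ((2 * pi) powr (- h)) * ?Y"
    by (subst nn_integral_cmult[symmetric]) (auto intro!: nn_integral_cong simp: gauss_def h_def mult_ac ennreal_mult')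
  have c: "ennreal ((2 * pi) powr (- h)) * ennreal (pi powr h / A) = ennreal (1 / (2 powr h * A))"
    using pos by (subst ennreal_mult[symmetric]) (auto simp: powr_mult powr_minus field_simps)
  have "?X * (ennreal (1 / (2 powr h * A)) * ennreal G) = ennreal (1 / (2 powr h * A)) * (?X * ennreal G)"
    by (simp only: mult_ac)
  also have "\<dots> = (ennreal ((2 * pi) powr (- h)) * ?Y) * (ennreal (pi powr h / A) * ?K)"
    unfolding X c[symmetric] by (simp only: mult_ac)
  finally show ?thesis by (simp only: r0 r y)
qed

end

section \<open>Third-order moments of a spherical law on a half-space\<close>

lemma homogeneous_weight_product:
  fixes b0 b1 :: "'e::euclidean_space"
  assumes [measurable]: "\<beta> \<in> borel_measurable borel" and \<beta>: "\<And>v. 0 \<le> \<beta> v" "\<And>v. \<beta> v \<le> \<bar>v\<bar> ^ l"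
    "\<And>r v. 0 < r \<Longrightarrow> \<beta> (r * v) = r ^ l * \<beta> v"
    and b: "b0 \<in> Basis" "b1 \<in> Basis"
  shows "homogeneous_weight (\<lambda>x. half_power i (x \<bullet> b0) * \<beta> (x \<bullet> b1)) (i + l) (real (DIM('e) + (i + l)) / 2)"
proof
  have [measurable]: "half_power i \<in> borel_measurable borel" by (rule half_power.measurable_weight)
  show "(\<lambda>x::'e. half_power i (x \<bullet> b0) * \<beta> (x \<bullet> b1)) \<in> borel_measurable borel" by measurable
  fix x :: 'e
  have "half_power i (x \<bullet> b0) \<le> \<bar>x \<bullet> b0\<bar> ^ i" by (simp add: half_power_def)
  also have "\<dots> \<le> norm x ^ i" by (intro power_mono Basis_le_norm b) auto
  finally have 1: "half_power i (x \<bullet> b0) \<le> norm x ^ i" .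
  have "\<beta> (x \<bullet> b1) \<le> \<bar>x \<bullet> b1\<bar> ^ l" by (rule \<beta>)
  also have "\<dots> \<le> norm x ^ l" by (intro power_mono Basis_le_norm b) auto
  finally have 2: "\<beta> (x \<bullet> b1) \<le> norm x ^ l" .
  show "half_power i (x \<bullet> b0) * \<beta> (x \<bullet> b1) \<le> norm x ^ (i + l)"
    unfolding power_add by (intro mult_mono 1 2 \<beta>) auto
qed (auto simp: \<beta> half_power.weight_nonneg half_power.weight_scale[unfolded real_scaleR_def] power_add)

text \<open>
  A spherical density whose moments of degree \<open>m \<le> D\<close> are \<open>\<rho> m\<close> times the Gaussian ones.  Degree
  \<open>0\<close> suffices for the total mass, which is needed before the finiteness of higher moments is known;
  the third-order computation takes \<open>D = 3\<close>.
\<close>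

locale spherical_half_space =
  fixes g :: "real \<Rightarrow> real" and b0 :: "'e::euclidean_space" and \<rho> :: "nat \<Rightarrow> real" and D :: nat
  assumes density_measurable[measurable]: "(\<lambda>x::'e. g (x \<bullet> x)) \<in> borel_measurable borel"
    and density_nonneg: "\<And>t. 0 \<le> t \<Longrightarrow> 0 \<le> g t"
    and b0: "b0 \<in> Basis"
    and dim_ge_2: "\<exists>b\<in>Basis. b \<noteq> b0"
    and \<rho>_nonneg: "\<And>m. 0 \<le> \<rho> m"
    and \<rho>_0: "\<rho> 0 = 1"
    and ratio: "\<And>p m \<kappa>. homogeneous_weight p m \<kappa> \<Longrightarrow> m \<le> D \<Longrightarrow>
      (\<integral>\<^sup>+x. ennreal (p x) * ennreal (g (x \<bullet> x)) \<partial>lborel) =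
      ennreal (\<rho> m) * (\<integral>\<^sup>+x. ennreal (p x) * ennreal (gauss (x :: 'e)) \<partial>lborel)"
begin

text \<open>
  The spherical law conditioned on the half-space \<open>0 < x \<bullet> b0\<close>, whose probability is
  one half.
\<close>

definition half_law :: "'e measure" where
  "half_law = density lborel (\<lambda>x. ennreal (2 * half_power 0 (x \<bullet> b0) * g (x \<bullet> x)))"

lemma half_power_measurable[measurable]: "half_power i \<in> borel_measurable borel"
  by (rule half_power.measurable_weight)

lemma sets_half_law[measurable_cong]: "sets half_law = sets borel"
  and space_half_law[simp]: "space half_law = UNIV"
  by (simp_all add: half_law_def)

lemma nn_integral_half_law:
  assumes [measurable]: "f \<in> borel_measurable borel" and "\<And>x. 0 \<le> f x"
  shows "(\<integral>\<^sup>+x. ennreal (f x) \<partial>half_law) =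
    (\<integral>\<^sup>+x. ennreal (2 * (half_power 0 (x \<bullet> b0) * f x)) * ennreal (g (x \<bullet> x)) \<partial>lborel)"
  unfolding half_law_def using assms density_nonneg
  by (subst nn_integral_density)
    (auto intro!: nn_integral_cong simp: half_power_def mult_ac simp flip: ennreal_mult')

lemma AE_half_law: "AE x in half_law. 0 < x \<bullet> b0"
  unfolding half_law_def by (subst AE_density) (auto simp: half_power_def)

text \<open>
  All nonvanishing moments come from here: the radial law contributes \<open>\<rho> (i + l)\<close>, and the rest is
  a product of two one-dimensional normal moments.
\<close>

lemma nn_integral_half_law_product:
  assumes [measurable]: "\<beta> \<in> borel_measurable borel" and \<beta>: "\<And>v. 0 \<le> \<beta> v" "\<And>v. \<beta> v \<le> \<bar>v\<bar> ^ l"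
    "\<And>r v. 0 < r \<Longrightarrow> \<beta> (r * v) = r ^ l * \<beta> v"
    and b1: "b1 \<in> Basis" "b1 \<noteq> b0" and le: "i + l \<le> D"
  shows "(\<integral>\<^sup>+x. ennreal (half_power i (x \<bullet> b0) * \<beta> (x \<bullet> b1)) \<partial>half_law) =
    ennreal (2 * \<rho> (i + l)) * ((\<integral>\<^sup>+u. ennreal (half_power i u * std_normal_density u) \<partial>lborel) *
    (\<integral>\<^sup>+v. ennreal (\<beta> v * std_normal_density v) \<partial>lborel))"
proof -
  let ?p = "\<lambda>x::'e. half_power i (x \<bullet> b0) * \<beta> (x \<bullet> b1)"
  interpret p: homogeneous_weight ?p "i + l" "real (DIM('e) + (i + l)) / 2"
    by (rule homogeneous_weight_product) (use \<beta> b0 b1 in auto)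
  have "(\<integral>\<^sup>+x. ennreal (?p x) \<partial>half_law) = (\<integral>\<^sup>+x. ennreal 2 * (ennreal (?p x) * ennreal (g (x \<bullet> x))) \<partial>lborel)"
    by (subst nn_integral_half_law) (auto intro!: nn_integral_cong
        simp: p.weight_nonneg half_power_def mult_ac ennreal_mult' \<beta>)
  also have "\<dots> = ennreal 2 * (\<integral>\<^sup>+x. ennreal (?p x) * ennreal (g (x \<bullet> x)) \<partial>lborel)"
    by (rule nn_integral_cmult) measurable
  also have "\<dots> = ennreal 2 * (ennreal (\<rho> (i + l)) * (\<integral>\<^sup>+x. ennreal (?p x) * ennreal (gauss x) \<partial>lborel))"
    by (simp only: ratio[OF p.homogeneous_weight_axioms le])
  also have "(\<integral>\<^sup>+x. ennreal (?p x) * ennreal (gauss x) \<partial>lborel) =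
    (\<integral>\<^sup>+u. ennreal (half_power i u * std_normal_density u) \<partial>lborel) *
    (\<integral>\<^sup>+v. ennreal (\<beta> v * std_normal_density v) \<partial>lborel)"
    using b1 by (intro nn_integral_gauss_pair b0) (auto simp: \<beta> half_power.weight_nonneg)
  finally show ?thesis
    using \<rho>_nonneg by (simp add: ennreal_mult mult.assoc)
qed

lemma nn_integral_std_normal_square: "(\<integral>\<^sup>+v. ennreal (v\<^sup>2 * std_normal_density v) \<partial>lborel) = 1"
proof -
  have "has_bochner_integral lborel (\<lambda>v. v\<^sup>2 * std_normal_density v) 1"
    using std_normal_moment_even[of 1] by (simp add: mult.commute)
  then show ?thesis
    by (subst nn_integral_eq_integral) (auto simp: has_bochner_integral_iff)
qed

lemma has_bochner_integral_half_law_I: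
  assumes [measurable]: "f \<in> borel_measurable borel" "h \<in> borel_measurable borel" and eq: "\<And>x. 0 < x \<bullet> b0 \<Longrightarrow> h x = f x"
    and nn: "\<And>x. 0 \<le> h x" and I: "(\<integral>\<^sup>+x. ennreal (h x) \<partial>half_law) = ennreal r" "0 \<le> r"
  shows "has_bochner_integral half_law f r"
proof -
  have "has_bochner_integral half_law h r"
    by (rule has_bochner_integral_nn_integral) (use I nn in auto)
  then show ?thesis
    by (subst has_bochner_integral_cong_AE[where g=h]) (use AE_half_law eq in auto)
qed

lemma half_line_moment:
  assumes "i \<le> D" "(\<integral>\<^sup>+u. ennreal (half_power i u * std_normal_density u) \<partial>lborel) = ennreal M" "0 \<le> M"
  shows "has_bochner_integral half_law (\<lambda>x. (x \<bullet> b0) ^ i) (2 * \<rho> i * M)"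
proof -
  obtain b1 where b1: "b1 \<in> Basis" "b1 \<noteq> b0" using dim_ge_2 by auto
  show ?thesis
  proof (rule has_bochner_integral_half_law_I[where h="\<lambda>x. half_power i (x \<bullet> b0)"])
    show "(\<integral>\<^sup>+x. ennreal (half_power i (x \<bullet> b0)) \<partial>half_law) = ennreal (2 * \<rho> i * M)"
      using nn_integral_half_law_product[of "\<lambda>_. 1" 0 b1 i] assms b1 \<rho>_nonneg
      by (simp add: nn_integral_std_normal ennreal_mult)
  qed (use assms \<rho>_nonneg in \<open>auto simp: half_power_def\<close>)
qed

lemma mixed_moment:
  assumes "i + 2 \<le> D" "(\<integral>\<^sup>+u. ennreal (half_power i u * std_normal_density u) \<partial>lborel) = ennreal M" "0 \<le> M"
    and b1: "b1 \<in> Basis" "b1 \<noteq> b0"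
  shows "has_bochner_integral half_law (\<lambda>x. (x \<bullet> b0) ^ i * (x \<bullet> b1)\<^sup>2) (2 * \<rho> (i + 2) * M)"
proof (rule has_bochner_integral_half_law_I[where h="\<lambda>x. half_power i (x \<bullet> b0) * (x \<bullet> b1)\<^sup>2"])
  show "(\<integral>\<^sup>+x. ennreal (half_power i (x \<bullet> b0) * (x \<bullet> b1)\<^sup>2) \<partial>half_law) = ennreal (2 * \<rho> (i + 2) * M)"
    using nn_integral_half_law_product[of "\<lambda>v. v\<^sup>2" 2 b1 i] assms \<rho>_nonneg
    by (simp add: nn_integral_std_normal_square power_mult_distrib flip: ennreal_mult ennreal_mult')
qed (use assms \<rho>_nonneg in \<open>auto simp: half_power_def\<close>)

text \<open>
  Under \<open>half_law\<close>, the first two moments of the coordinate along \<open>b0\<close> and half of the third.  The factor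
  \<open>sqrt (2 / pi)\<close> is the first absolute moment of the standard normal distribution.
\<close>

definition "\<aa> = \<rho> 1 * sqrt (2 / pi)"
definition "\<bb> = \<rho> 2"
definition "\<cc> = \<rho> 3 * sqrt (2 / pi)"

lemma sqrt_two_over_pi: "2 / sqrt (2 * pi) = sqrt (2 / pi)"
  by (simp add: real_sqrt_mult real_sqrt_divide field_simps)

lemma moment_0: "has_bochner_integral half_law (\<lambda>x. 1 :: real) 1"
  using half_line_moment[OF _ half_normal_moments(1)] by (simp add: \<rho>_0)

lemma prob_space_half_law: "prob_space half_law"
proof
  have "emeasure half_law UNIV = (\<integral>\<^sup>+x. ennreal 1 \<partial>half_law)" by simp
  also have "\<dots> = ennreal 1"
    using moment_0 unfolding has_bochner_integral_iff
    by (subst nn_integral_eq_integral) auto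
  finally show "emeasure half_law (space half_law) = 1" by simp
qed

context
  assumes D3: "3 \<le> D"
begin

lemma
  shows moment_u: "has_bochner_integral half_law (\<lambda>x. x \<bullet> b0) \<aa>"
    and moment_uu: "has_bochner_integral half_law (\<lambda>x. (x \<bullet> b0)\<^sup>2) \<bb>"
    and moment_uuu: "has_bochner_integral half_law (\<lambda>x. (x \<bullet> b0) ^ 3) (2 * \<cc>)"
    and moment_vv: "b \<in> Basis \<Longrightarrow> b \<noteq> b0 \<Longrightarrow> has_bochner_integral half_law (\<lambda>x. (x \<bullet> b)\<^sup>2) \<bb>"
    and moment_uvv: "b \<in> Basis \<Longrightarrow> b \<noteq> b0 \<Longrightarrow> has_bochner_integral half_law (\<lambda>x. (x \<bullet> b0) * (x \<bullet> b)\<^sup>2) \<cc>"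
  using half_line_moment[OF _ half_normal_moments(2)]
    half_line_moment[OF _ half_normal_moments(3)] half_line_moment[OF _ half_normal_moments(4)]
    mixed_moment[OF _ half_normal_moments(1)] mixed_moment[OF _ half_normal_moments(2)]
    D3
  by (simp_all add: \<aa>_def \<bb>_def \<cc>_def mult_ac numeral_3_eq_3 numeral_2_eq_2 flip: sqrt_two_over_pi)

text \<open>
  If \<open>\<bb>\<close> were zero, the coordinate along \<open>b0\<close> would vanish almost surely, but it is positive.
\<close>

lemma second_moment_pos: "0 < \<bb>"
proof -
  interpret prob_space half_law by (rule prob_space_half_law)
  note uu = moment_uu[unfolded has_bochner_integral_iff]
  have "\<bb> \<noteq> 0"
  proof
    assume "\<bb> = 0"
    then have "AE x in half_law. (x \<bullet> b0)\<^sup>2 = 0"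
      using uu by (subst integral_nonneg_eq_0_iff_AE[symmetric]) auto
    with AE_half_law have "AE x in half_law. False" by eventually_elim auto
    then show False by simp
  qed
  moreover have "0 \<le> \<bb>" using \<rho>_nonneg by (simp add: \<bb>_def)
  ultimately show ?thesis by simp
qed

lemma first_moment_square_le: "\<aa>\<^sup>2 \<le> \<bb>"
proof -
  have "has_bochner_integral half_law (\<lambda>x. (x \<bullet> b0)\<^sup>2 + (- 2 * \<aa>) * (x \<bullet> b0) + \<aa>\<^sup>2 * 1) (\<bb> + (- 2 * \<aa>) * \<aa> + \<aa>\<^sup>2 * 1)"
    by (intro has_bochner_integral_add has_bochner_integral_mult_right moment_0 moment_u moment_uu)
  moreover have "0 \<le> (x \<bullet> b0)\<^sup>2 + (- 2 * \<aa>) * (x \<bullet> b0) + \<aa>\<^sup>2 * 1" for x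
    using zero_le_power2[of "x \<bullet> b0 - \<aa>"] by (simp add: power2_eq_square algebra_simps)
  then have "0 \<le> (\<integral>x. (x \<bullet> b0)\<^sup>2 + (- 2 * \<aa>) * (x \<bullet> b0) + \<aa>\<^sup>2 * 1 \<partial>half_law)"
    by (rule Bochner_Integration.integral_nonneg)
  ultimately have "0 \<le> \<bb> + (- 2 * \<aa>) * \<aa> + \<aa>\<^sup>2 * 1"
    by (simp only: has_bochner_integral_iff)
  then show ?thesis by (simp add: power2_eq_square)
qed

lemma integrable_norm_cube: "integrable half_law (\<lambda>x. norm x ^ 3)"
proof (rule integrableI_bounded)
  interpret w: homogeneous_weight "\<lambda>x::'e. norm x ^ 3" 3 "real (DIM('e) + 3) / 2"
    by standard (auto simp: power_mult_distrib)
  have "(\<integral>\<^sup>+x. ennreal (norm (norm x ^ 3)) \<partial>half_law) =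
     (\<integral>\<^sup>+x. ennreal (2 * (half_power 0 (x \<bullet> b0) * norm x ^ 3)) * ennreal (g (x \<bullet> x)) \<partial>lborel)"
    by (subst nn_integral_half_law) auto
  also have "\<dots> \<le> (\<integral>\<^sup>+x. ennreal 2 * (ennreal (norm x ^ 3) * ennreal (g (x \<bullet> x))) \<partial>(lborel :: 'e measure))"
    by (intro nn_integral_mono)
      (auto simp: half_power_def ennreal_mult' mult.assoc)
  also have "\<dots> = ennreal 2 * (\<integral>\<^sup>+x. ennreal (norm x ^ 3) * ennreal (g (x \<bullet> x)) \<partial>(lborel :: 'e measure))"
    by (rule nn_integral_cmult) measurable
  also have "\<dots> = ennreal 2 * (ennreal (\<rho> 3) * (\<integral>\<^sup>+x. ennreal (norm x ^ 3) * ennreal (gauss x) \<partial>(lborel :: 'e measure)))"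
    using D3 by (subst ratio[OF w.homogeneous_weight_axioms]) auto
  also have "\<dots> < \<infinity>"
    using w.nn_integral_gauss_finite by (simp add: ennreal_mult_less_top)
  finally show "(\<integral>\<^sup>+x. ennreal (norm (norm x ^ 3)) \<partial>half_law) < \<infinity>" .
qed measurable

lemma integrable_cubic_growth:
  fixes f :: "'e \<Rightarrow> real"
  assumes [measurable]: "f \<in> borel_measurable borel" and f: "\<And>x. \<bar>f x\<bar> \<le> C * (1 + norm x) ^ 3"
  shows "integrable half_law f"
proof (rule Bochner_Integration.integrable_bound)
  interpret prob_space half_law by (rule prob_space_half_law)
  show "integrable half_law (\<lambda>x. 8 * \<bar>C\<bar> * (1 + norm x ^ 3))"
    using integrable_norm_cube by auto
  show "AE x in half_law. norm (f x) \<le> norm (8 * \<bar>C\<bar> * (1 + norm x ^ 3))"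
  proof (rule AE_I2)
    fix x :: 'e
    have "(1 + norm x) ^ 3 \<le> 8 * (1 + norm x ^ 3)"
    proof (cases "norm x \<le> 1")
      case True
      then have "(1 + norm x) ^ 3 \<le> 2 ^ 3" by (intro power_mono) auto
      then have "(1 + norm x) ^ 3 \<le> 8" by simp
      then show ?thesis by (rule order_trans) simp
    next
      case False
      then have "(1 + norm x) ^ 3 \<le> (2 * norm x) ^ 3" by (intro power_mono) auto
      then show ?thesis by (simp add: power_mult_distrib)
    qed
    then have "C * (1 + norm x) ^ 3 \<le> \<bar>C\<bar> * (8 * (1 + norm x ^ 3))"
      by (intro mult_mono) auto
    then show "norm (f x) \<le> norm (8 * \<bar>C\<bar> * (1 + norm x ^ 3))"
      using f[of x] by (simp add: abs_mult mult_ac)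
  qed
qed measurable

text \<open>
  A sign change of coordinates other than \<open>b0\<close> preserves both the spherical density and the
  half-space.
\<close>

lemma integral_odd:
  fixes f :: "'e \<Rightarrow> real" and \<sigma> :: "'e \<Rightarrow> real"
  assumes [measurable]: "f \<in> borel_measurable borel"
    and \<sigma>: "\<And>b. b \<in> Basis \<Longrightarrow> \<bar>\<sigma> b\<bar> = 1" "\<sigma> b0 = 1"
    and odd: "\<And>x y. (\<And>b. b \<in> Basis \<Longrightarrow> y \<bullet> b = \<sigma> b * (x \<bullet> b)) \<Longrightarrow> f y = - f x"
  shows "(\<integral>x. f x \<partial>half_law) = 0"
proof -
  define T :: "'e \<Rightarrow> 'e" where "T x = 0 + (\<Sum>b\<in>Basis. (\<sigma> b * (x \<bullet> b)) *\<^sub>R b)" for x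
  have T[measurable]: "T \<in> borel_measurable borel"
    unfolding T_def[abs_def] by measurable
  have nz: "\<sigma> b \<noteq> 0" if "b \<in> Basis" for b using \<sigma>(1)[OF that] by auto
  have "lborel = density (distr lborel borel T) (\<lambda>_. ennreal (\<Prod>j\<in>Basis. \<bar>\<sigma> j\<bar>))"
    unfolding T_def[abs_def] by (rule lborel_affine_euclidean) (rule nz)
  then have eq: "distr lborel borel T = lborel"
    by (simp add: \<sigma> density_1)
  have Tb: "T x \<bullet> b = \<sigma> b * (x \<bullet> b)" if "b \<in> Basis" for x b
    using that by (simp add: T_def inner_sum_left inner_Basis if_distrib cong: if_cong)
  have TT: "T x \<bullet> T x = x \<bullet> x" for x
  proof -
    have "(\<sigma> b * (x \<bullet> b)) * (\<sigma> b * (x \<bullet> b)) = (x \<bullet> b) * (x \<bullet> b)" if "b \<in> Basis" for b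
    proof -
      have "\<sigma> b * \<sigma> b = 1" using \<sigma>(1)[OF that] by (metis abs_mult_self_eq mult_1)
      then show ?thesis by (metis mult.assoc mult.commute mult_1)
    qed
    then have "(\<Sum>b\<in>Basis. (T x \<bullet> b) * (T x \<bullet> b)) = (\<Sum>b\<in>Basis. (x \<bullet> b) * (x \<bullet> b))"
      by (intro sum.cong refl) (simp only: Tb)
    then show ?thesis by (simp add: euclidean_inner[of x x] euclidean_inner[of "T x" "T x"])
  qed
  define h where "h x = 2 * half_power 0 (x \<bullet> b0) * g (x \<bullet> x)" for x :: 'e
  have [measurable]: "h \<in> borel_measurable borel" unfolding h_def[abs_def] by measurable
  have h: "0 \<le> h x" "h (T x) = h x" for x
    using density_nonneg[of "x \<bullet> x"] by (auto simp: h_def half_power_def Tb b0 \<sigma> TT)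
  have "(\<integral>x. f x \<partial>half_law) = (\<integral>x. h x * f x \<partial>lborel)"
    unfolding half_law_def h_def[symmetric] using h by (subst integral_density) auto
  also have "\<dots> = (\<integral>x. h x * f x \<partial>distr lborel borel T)" by (simp add: eq)
  also have "\<dots> = (\<integral>x. h (T x) * f (T x) \<partial>lborel)"
    by (subst integral_distr) auto
  also have "\<dots> = - (\<integral>x. h x * f x \<partial>lborel)"
    by (simp add: h odd[OF Tb])
  also have "(\<integral>x. h x * f x \<partial>lborel) = (\<integral>x. f x \<partial>half_law)"
    unfolding half_law_def h_def[symmetric] using h by (subst integral_density) auto
  finally show ?thesis by simp
qed

lemma odd_coordinate_moment:
  fixes f :: "'e \<Rightarrow> real"
  assumes f: "f \<in> borel_measurable borel" "\<And>x. \<bar>f x\<bar> \<le> C * (1 + norm x) ^ 3"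
    and b: "b \<in> Basis" "b \<noteq> b0"
    and odd: "\<And>x y. y \<bullet> b = - (x \<bullet> b) \<Longrightarrow> (\<And>b'. b' \<in> Basis \<Longrightarrow> b' \<noteq> b \<Longrightarrow> y \<bullet> b' = x \<bullet> b') \<Longrightarrow> f y = - f x"
  shows "has_bochner_integral half_law f 0"
proof -
  have "(\<integral>x. f x \<partial>half_law) = 0"
    by (rule integral_odd[where \<sigma>="\<lambda>b'. if b' = b then -1 else 1"]) (use f b in \<open>auto intro!: odd\<close>)
  then show ?thesis
    using integrable_cubic_growth[OF f] by (simp add: has_bochner_integral_iff)
qed

text \<open>
  The centred coordinates of the whitened vector: \<open>e\<close> is the direction of the skewness, where the
  half-space coordinate is mixed in with weight \<open>d\<close> and the mean \<open>\<aa> * d\<close> is subtracted.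
\<close>

definition skew_coord :: "real \<Rightarrow> real \<Rightarrow> 'e \<Rightarrow> 'e \<Rightarrow> 'e \<Rightarrow> real" where
  "skew_coord d s e b x = (if b = e then d * (x \<bullet> b0) + s * (x \<bullet> e) - \<aa> * d else x \<bullet> b)"

lemma skew_coord_measurable[measurable]: "skew_coord d s e b \<in> borel_measurable borel"
  unfolding skew_coord_def[abs_def] by measurable

context
  fixes d s :: real and e :: 'e
  assumes ds: "d\<^sup>2 + s\<^sup>2 = 1" and e: "e \<in> Basis" "e \<noteq> b0"
begin

text \<open>
  By Jensen's inequality \<open>\<aa>\<^sup>2 \<le> \<bb>\<close>, and \<open>d\<^sup>2 < 1\<close> makes the inequality strict because \<open>\<bb>\<close> is
  positive.
\<close>

lemma skewed_variance_pos:
  assumes "0 < s"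
  shows "0 < \<bb> - \<aa>\<^sup>2 * d\<^sup>2"
proof -
  have "\<aa>\<^sup>2 * d\<^sup>2 \<le> \<bb> * d\<^sup>2" by (intro mult_right_mono first_moment_square_le) auto
  moreover have "\<bb> * d\<^sup>2 < \<bb>"
  proof -
    have "d\<^sup>2 < 1" using ds zero_less_power[OF assms, of 2] by linarith
    then show ?thesis using second_moment_pos by simp
  qed
  ultimately show ?thesis by simp
qed

lemma skew_coord_growth: "b \<in> Basis \<Longrightarrow> \<bar>skew_coord d s e b x\<bar> \<le> (\<bar>d\<bar> + \<bar>s\<bar> + \<bar>\<aa> * d\<bar> + 1) * (1 + norm x)"
proof -
  assume b: "b \<in> Basis"
  have u: "\<bar>x \<bullet> b'\<bar> \<le> norm x" if "b' \<in> Basis" for b' using Basis_le_norm[OF that] .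
  show ?thesis
  proof (cases "b = e")
    case True
    have "\<bar>skew_coord d s e b x\<bar> \<le> \<bar>d\<bar> * \<bar>x \<bullet> b0\<bar> + \<bar>s\<bar> * \<bar>x \<bullet> e\<bar> + \<bar>\<aa> * d\<bar>"
      unfolding skew_coord_def abs_mult[symmetric] using True by (simp del: abs_mult)
    also have "\<dots> \<le> \<bar>d\<bar> * norm x + \<bar>s\<bar> * norm x + \<bar>\<aa> * d\<bar>"
      by (intro add_mono mult_left_mono u b0 e) auto
    also have "\<dots> \<le> (\<bar>d\<bar> + \<bar>s\<bar> + \<bar>\<aa> * d\<bar> + 1) * (1 + norm x)"
      using mult_nonneg_nonneg[of "\<bar>\<aa> * d\<bar>" "norm x"] by (simp add: algebra_simps)
    finally show ?thesis .
  next
    case False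
    have "\<bar>skew_coord d s e b x\<bar> \<le> 1 * (1 + norm x)" using u[OF b] False by (simp add: skew_coord_def)
    also have "\<dots> \<le> (\<bar>d\<bar> + \<bar>s\<bar> + \<bar>\<aa> * d\<bar> + 1) * (1 + norm x)"
      by (intro mult_right_mono) auto
    finally show ?thesis .
  qed
qed

text \<open>
  Moments of lower degree are treated as products with constant factors.
\<close>

lemma cubic_growth_products:
  fixes f1 f2 f3 :: "'e \<Rightarrow> real"
  assumes "\<And>x. \<bar>f1 x\<bar> \<le> C1 * (1 + norm x)" "\<And>x. \<bar>f2 x\<bar> \<le> C2 * (1 + norm x)" "\<And>x. \<bar>f3 x\<bar> \<le> C3 * (1 + norm x)"
  shows "\<bar>f1 x * f2 x * f3 x\<bar> \<le> (C1 * C2 * C3) * (1 + norm x) ^ 3"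
proof -
  have "\<bar>f1 x\<bar> * \<bar>f2 x\<bar> * \<bar>f3 x\<bar> \<le> (C1 * (1 + norm x)) * (C2 * (1 + norm x)) * (C3 * (1 + norm x))"
    using order_trans[OF abs_ge_zero assms(1)[of x]] order_trans[OF abs_ge_zero assms(2)[of x]]
    by (intro mult_mono assms mult_nonneg_nonneg[of "C1 * (1 + norm x)" "C2 * (1 + norm x)"]) auto
  then show ?thesis by (simp add: abs_mult power3_eq_cube mult_ac)
qed

lemma coordinate_growth: "b \<in> Basis \<Longrightarrow> \<bar>x \<bullet> b\<bar> \<le> 1 * (1 + norm x)" for x :: 'e
  using Basis_le_norm[of b x] by simp

lemma one_growth: "\<bar>1::real\<bar> \<le> 1 * (1 + norm x)" for x :: 'e
  by simp

lemma integrable_skew_coord3: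
  assumes "b \<in> Basis" "b' \<in> Basis" "b'' \<in> Basis"
  shows "integrable half_law (\<lambda>x. skew_coord d s e b x * skew_coord d s e b' x * skew_coord d s e b'' x)"
  by (rule integrable_cubic_growth[OF _ cubic_growth_products])
    (measurable, (rule skew_coord_growth assms)+)

lemma integrable_skew_coord2:
  assumes "b \<in> Basis" "b' \<in> Basis"
  shows "integrable half_law (\<lambda>x. skew_coord d s e b x * skew_coord d s e b' x)"
  using integrable_cubic_growth[OF _ cubic_growth_products[OF skew_coord_growth[OF assms(1)] skew_coord_growth[OF assms(2)] one_growth]]
  by simp

lemma integrable_skew_coord:
  assumes "b \<in> Basis"
  shows "integrable half_law (skew_coord d s e b)"
  using integrable_cubic_growth[OF _ cubic_growth_products[OF skew_coord_growth[OF assms(1)] one_growth one_growth]]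
  by simp

lemma odd_monomials:
  assumes v: "v \<in> Basis" "v \<noteq> b0"
  shows "has_bochner_integral half_law (\<lambda>x. x \<bullet> v) 0"
    and "has_bochner_integral half_law (\<lambda>x. (x \<bullet> b0) * (x \<bullet> v)) 0"
    and "has_bochner_integral half_law (\<lambda>x. (x \<bullet> b0)\<^sup>2 * (x \<bullet> v)) 0"
    and "w \<in> Basis \<Longrightarrow> w \<noteq> b0 \<Longrightarrow> has_bochner_integral half_law (\<lambda>x. (x \<bullet> w)\<^sup>2 * (x \<bullet> v)) 0"
proof -
  note growth = cubic_growth_products[OF coordinate_growth coordinate_growth coordinate_growth]
    cubic_growth_products[OF one_growth coordinate_growth coordinate_growth]
    cubic_growth_products[OF one_growth one_growth coordinate_growth]
  show "has_bochner_integral half_law (\<lambda>x. x \<bullet> v) 0"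
    using odd_coordinate_moment[OF _ growth(3)[OF v(1)] v] by simp
  show "has_bochner_integral half_law (\<lambda>x. (x \<bullet> b0) * (x \<bullet> v)) 0"
    using odd_coordinate_moment[OF _ growth(2)[OF b0 v(1)] v] v b0 by simp
  show "has_bochner_integral half_law (\<lambda>x. (x \<bullet> b0)\<^sup>2 * (x \<bullet> v)) 0"
    using odd_coordinate_moment[OF _ growth(1)[OF b0 b0 v(1)] v] v b0 by (simp add: power2_eq_square)
  show "has_bochner_integral half_law (\<lambda>x. (x \<bullet> w)\<^sup>2 * (x \<bullet> v)) 0" if "w \<in> Basis" "w \<noteq> b0"
    using odd_coordinate_moment[OF _ growth(1)[OF that(1) that(1) v(1)] v] v b0 that
    by (cases "w = v") (simp_all add: power2_eq_square)
qed

lemma skew_coord_mean: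
  assumes b: "b \<in> Basis" "b \<noteq> b0"
  shows "(\<integral>x. skew_coord d s e b x \<partial>half_law) = 0"
proof (cases "b = e")
  case True
  have "has_bochner_integral half_law (\<lambda>x. d * (x \<bullet> b0) + s * (x \<bullet> e) - \<aa> * d * 1) (d * \<aa> + s * 0 - \<aa> * d * 1)"
    by (intro has_bochner_integral_add has_bochner_integral_diff has_bochner_integral_mult_right
        moment_u moment_0 odd_monomials e)
  then show ?thesis using True by (simp add: skew_coord_def has_bochner_integral_iff)
next
  case False
  then show ?thesis using odd_monomials(1)[OF b] by (simp add: skew_coord_def has_bochner_integral_iff)
qed

lemma skew_coord_variance:
  assumes b: "b \<in> Basis" "b \<noteq> b0"
  shows "(\<integral>x. skew_coord d s e b x * skew_coord d s e b x \<partial>half_law) = (if b = e then \<bb> - \<aa>\<^sup>2 * d\<^sup>2 else \<bb>)"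
proof (cases "b = e")
  case True
  let ?u = "\<lambda>x::'e. x \<bullet> b0" and ?v = "\<lambda>x::'e. x \<bullet> e"
  have "has_bochner_integral half_law
    (\<lambda>x. d\<^sup>2 * (?u x)\<^sup>2 + s\<^sup>2 * (?v x)\<^sup>2 + (2 * d * s) * (?u x * ?v x) + (- 2 * \<aa> * d\<^sup>2) * ?u x
       + (- 2 * \<aa> * d * s) * ?v x + (\<aa>\<^sup>2 * d\<^sup>2) * 1)
    (d\<^sup>2 * \<bb> + s\<^sup>2 * \<bb> + (2 * d * s) * 0 + (- 2 * \<aa> * d\<^sup>2) * \<aa> + (- 2 * \<aa> * d * s) * 0 + (\<aa>\<^sup>2 * d\<^sup>2) * 1)"
    by (intro has_bochner_integral_add has_bochner_integral_mult_right
        moment_u moment_0 moment_uu moment_vv odd_monomials e)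
  moreover have "(\<lambda>x. d\<^sup>2 * (?u x)\<^sup>2 + s\<^sup>2 * (?v x)\<^sup>2 + (2 * d * s) * (?u x * ?v x) + (- 2 * \<aa> * d\<^sup>2) * ?u x
       + (- 2 * \<aa> * d * s) * ?v x + (\<aa>\<^sup>2 * d\<^sup>2) * 1) = (\<lambda>x. skew_coord d s e b x * skew_coord d s e b x)"
    using True by (auto simp: skew_coord_def fun_eq_iff power2_eq_square algebra_simps)
  moreover have "d\<^sup>2 * \<bb> + s\<^sup>2 * \<bb> + (2 * d * s) * 0 + (- 2 * \<aa> * d\<^sup>2) * \<aa> + (- 2 * \<aa> * d * s) * 0 + (\<aa>\<^sup>2 * d\<^sup>2) * 1
      = \<bb> - \<aa>\<^sup>2 * d\<^sup>2"
    using ds by algebra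
  ultimately show ?thesis using True by (simp only: has_bochner_integral_iff if_True simp_thms)
next
  case False
  then show ?thesis using moment_vv[OF b] by (simp add: skew_coord_def has_bochner_integral_iff power2_eq_square)
qed

lemma skew_coord_covariance:
  assumes b: "b \<in> Basis" "b \<noteq> b0" "b' \<in> Basis" "b' \<noteq> b0" "b \<noteq> b'"
  shows "(\<integral>x. skew_coord d s e b x * skew_coord d s e b' x \<partial>half_law) = 0"
proof -
  have *: "has_bochner_integral half_law (\<lambda>x. skew_coord d s e v x * skew_coord d s e w x * 1) 0"
    if "v \<in> Basis" "v \<noteq> b0" "v \<noteq> e" "w \<in> Basis" "w \<noteq> b0" "v \<noteq> w" for v w
    by (rule odd_coordinate_moment[OF _ cubic_growth_products[OF skew_coord_growth skew_coord_growth one_growth], where b=v])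
       (use that e b0 in \<open>auto simp: skew_coord_def\<close>)
  show ?thesis
    using *[of b b'] *[of b' b] b by (cases "b = e") (auto simp: has_bochner_integral_iff mult.commute)
qed

lemma skew_coord_third_eee:
  "(\<integral>x. skew_coord d s e e x * skew_coord d s e e x * skew_coord d s e e x \<partial>half_law) = 3 * (\<cc> - \<aa> * \<bb>) * d + (2 * \<aa> ^ 3 - \<cc>) * d ^ 3"
proof -
  let ?u = "\<lambda>x::'e. x \<bullet> b0" and ?v = "\<lambda>x::'e. x \<bullet> e"
  have "has_bochner_integral half_law
    (\<lambda>x. d ^ 3 * ?u x ^ 3 + (3 * d\<^sup>2 * s) * ((?u x)\<^sup>2 * ?v x) + (3 * d * s\<^sup>2) * (?u x * (?v x)\<^sup>2) + s ^ 3 * ((?v x)\<^sup>2 * ?v x)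
       + (- 3 * \<aa> * d ^ 3) * (?u x)\<^sup>2 + (- 6 * \<aa> * d\<^sup>2 * s) * (?u x * ?v x) + (- 3 * \<aa> * d * s\<^sup>2) * (?v x)\<^sup>2
       + (3 * \<aa>\<^sup>2 * d ^ 3) * ?u x + (3 * \<aa>\<^sup>2 * d\<^sup>2 * s) * ?v x + (- (\<aa> ^ 3 * d ^ 3)) * 1)
    (d ^ 3 * (2 * \<cc>) + (3 * d\<^sup>2 * s) * 0 + (3 * d * s\<^sup>2) * \<cc> + s ^ 3 * 0
       + (- 3 * \<aa> * d ^ 3) * \<bb> + (- 6 * \<aa> * d\<^sup>2 * s) * 0 + (- 3 * \<aa> * d * s\<^sup>2) * \<bb>
       + (3 * \<aa>\<^sup>2 * d ^ 3) * \<aa> + (3 * \<aa>\<^sup>2 * d\<^sup>2 * s) * 0 + (- (\<aa> ^ 3 * d ^ 3)) * 1)" (is "has_bochner_integral half_law ?f ?m")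
    by (intro has_bochner_integral_add has_bochner_integral_mult_right
        moment_u moment_0 moment_uu moment_vv moment_uuu moment_uvv odd_monomials e)
  moreover have "?f = (\<lambda>x. skew_coord d s e e x * skew_coord d s e e x * skew_coord d s e e x)"
    by (auto simp: skew_coord_def fun_eq_iff power2_eq_square power3_eq_cube algebra_simps)
  moreover have "?m = 3 * (\<cc> - \<aa> * \<bb>) * d + (2 * \<aa> ^ 3 - \<cc>) * d ^ 3"
  proof -
    have s: "s\<^sup>2 = 1 - d\<^sup>2" using ds by simp
    show ?thesis unfolding s by (simp add: power2_eq_square power3_eq_cube algebra_simps)
  qed
  ultimately show ?thesis by (simp only: has_bochner_integral_iff)
qed

lemma skew_coord_third_eww:
  assumes w: "w \<in> Basis" "w \<noteq> b0" "w \<noteq> e"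
  shows "(\<integral>x. skew_coord d s e e x * skew_coord d s e w x * skew_coord d s e w x \<partial>half_law) = (\<cc> - \<aa> * \<bb>) * d"
proof -
  let ?u = "\<lambda>x::'e. x \<bullet> b0" and ?v = "\<lambda>x::'e. x \<bullet> e" and ?w = "\<lambda>x::'e. x \<bullet> w"
  have "has_bochner_integral half_law (\<lambda>x. d * (?u x * (?w x)\<^sup>2) + s * ((?w x)\<^sup>2 * ?v x) - (\<aa> * d) * (?w x)\<^sup>2)
     (d * \<cc> + s * 0 - \<aa> * d * \<bb>)"
    by (intro has_bochner_integral_add has_bochner_integral_diff has_bochner_integral_mult_right
        moment_uvv moment_vv odd_monomials e w)
  moreover have "(\<lambda>x. d * (?u x * (?w x)\<^sup>2) + s * ((?w x)\<^sup>2 * ?v x) - (\<aa> * d) * (?w x)\<^sup>2) =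
    (\<lambda>x. skew_coord d s e e x * skew_coord d s e w x * skew_coord d s e w x)"
    using w by (auto simp: skew_coord_def fun_eq_iff power2_eq_square algebra_simps)
  ultimately show ?thesis by (simp add: has_bochner_integral_iff algebra_simps)
qed

text \<open>
  In every remaining case some direction other than \<open>e\<close> occurs an odd number of times, and
  reflecting it changes the sign of the integrand.
\<close>

lemma skew_coord_third_zero:
  assumes b: "b \<in> Basis" "b \<noteq> b0" "b' \<in> Basis" "b' \<noteq> b0" "b'' \<in> Basis" "b'' \<noteq> b0"
    and not: "\<not> (b = e \<and> b' = b'')" "\<not> (b' = e \<and> b = b'')" "\<not> (b'' = e \<and> b = b')"
  shows "(\<integral>x. skew_coord d s e b x * skew_coord d s e b' x * skew_coord d s e b'' x \<partial>half_law) = 0"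
proof -
  have *: "has_bochner_integral half_law (\<lambda>x. skew_coord d s e v x * skew_coord d s e w x * skew_coord d s e w' x) 0"
    if "v \<in> Basis" "v \<noteq> b0" "v \<noteq> e" "w \<in> Basis" "w' \<in> Basis" "(w = v) = (w' = v)" for v w w'
    by (rule odd_coordinate_moment[OF _ cubic_growth_products[OF skew_coord_growth skew_coord_growth skew_coord_growth], where b=v])
       (use that e b0 in \<open>auto simp: skew_coord_def\<close>)
  consider "b \<noteq> e" "(b' = b) = (b'' = b)" | "b' \<noteq> e" "(b = b') = (b'' = b')" | "b'' \<noteq> e" "(b' = b'') = (b = b'')"
    using not by metis
  then show ?thesis
    using *[of b b' b''] *[of b' b b''] *[of b'' b' b] b
    by cases (simp_all add: has_bochner_integral_iff mult_ac)
qed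

end

end

end

section \<open>Whitening the scale matrix\<close>

lemma
  fixes A :: "real ^ 'n ^ 'n"
  assumes "invertible A"
  shows matrix_inv_left: "matrix_inv A ** A = mat 1"
    and matrix_inv_right: "A ** matrix_inv A = mat 1"
proof -
  have "A ** matrix_inv A = mat 1 \<and> matrix_inv A ** A = mat 1"
    unfolding matrix_inv_def by (rule someI_ex) (use assms in \<open>simp add: invertible_def\<close>)
  then show "matrix_inv A ** A = mat 1" "A ** matrix_inv A = mat 1" by simp_all
qed

lemma quadratic_form_scaleR:
  fixes P :: "real ^ 'n ^ 'n"
  shows "(c *\<^sub>R x) \<bullet> (P *v (c *\<^sub>R x)) = c\<^sup>2 * (x \<bullet> (P *v x))"
  by (simp only: matrix_vector_mult_scaleR inner_scaleR_left inner_scaleR_right power2_eq_square mult.assoc)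

lemma symmetric_positive_definite_inverse:
  fixes \<Omega> :: "real ^ 'n ^ 'n"
  assumes "symmetric_positive_definite \<Omega>"
  shows "invertible \<Omega>" and "symmetric_positive_definite (matrix_inv \<Omega>)"
proof -
  have sym: "transpose \<Omega> = \<Omega>" and pos: "\<And>x. x \<noteq> 0 \<Longrightarrow> 0 < x \<bullet> (\<Omega> *v x)"
    using assms by (auto simp: symmetric_positive_definite_def)
  have "x = 0" if "\<Omega> *v x = 0" for x
    using pos[of x] that by (cases "x = 0") auto
  then show inv: "invertible \<Omega>"
    unfolding invertible_left_inverse matrix_left_invertible_ker by blast
  have tr: "transpose (matrix_inv \<Omega>) = matrix_inv \<Omega>"
  proof -
    have "\<Omega> ** transpose (matrix_inv \<Omega>) = mat 1"
      using matrix_transpose_mul[of "matrix_inv \<Omega>" \<Omega>] by (simp add: sym matrix_inv_left[OF inv])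
    then have "matrix_inv \<Omega> ** (\<Omega> ** transpose (matrix_inv \<Omega>)) = matrix_inv \<Omega>" by simp
    then show ?thesis by (simp add: matrix_mul_assoc matrix_inv_left[OF inv])
  qed
  have "0 < x \<bullet> (matrix_inv \<Omega> *v x)" if "x \<noteq> 0" for x
  proof -
    define y where "y = matrix_inv \<Omega> *v x"
    have x: "\<Omega> *v y = x"
      by (simp add: y_def matrix_vector_mul_assoc matrix_inv_right[OF inv])
    then have "y \<noteq> 0" using that by auto
    then show ?thesis using pos[of y] by (simp add: x y_def[symmetric] inner_commute)
  qed
  with tr show "symmetric_positive_definite (matrix_inv \<Omega>)"
    by (simp add: symmetric_positive_definite_def)
qed

text \<open>
  Gram-Schmidt for the form \<open>P\<close>: the images under \<open>P\<close> of the vectors found so far span a proper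
  subspace, and a vector in its Euclidean orthogonal complement is orthogonal to them for the form.
\<close>

lemma orthonormal_extension:
  fixes P :: "real ^ 'n ^ 'n"
  assumes P: "symmetric_positive_definite P" and v: "v \<bullet> (P *v v) = 1"
    and m: "m < CARD('n)"
  shows "\<exists>S. v \<in> S \<and> finite S \<and> card S = Suc m \<and> (\<forall>x\<in>S. \<forall>y\<in>S. x \<bullet> (P *v y) = (if x = y then 1 else 0))"
  using m
proof (induction m)
  case 0
  show ?case by (rule exI[of _ "{v}"]) (use v in auto)
next
  case (Suc m)
  then obtain S where S: "v \<in> S" "finite S" "card S = Suc m"
    and on: "\<And>x y. x \<in> S \<Longrightarrow> y \<in> S \<Longrightarrow> x \<bullet> (P *v y) = (if x = y then 1 else 0)"
    by auto
  have "dim ((*v) P ` S) \<le> card ((*v) P ` S)"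
    by (intro dim_le_card') (use S in auto)
  also have "\<dots> \<le> card S" by (rule card_image_le) (rule S)
  also have "\<dots> < DIM(real ^ 'n)" using S Suc.prems by simp
  finally obtain x where x: "x \<noteq> 0" "\<And>y. y \<in> span ((*v) P ` S) \<Longrightarrow> orthogonal x y"
    by (rule orthogonal_to_subspace_exists) blast
  have xS: "x \<bullet> (P *v y) = 0" if "y \<in> S" for y
    using x(2)[of "P *v y"] that by (auto simp: orthogonal_def span_base)
  have sym: "a \<bullet> (P *v b) = b \<bullet> (P *v a)" for a b
    using P dot_lmul_matrix[of a P b] by (simp add: symmetric_positive_definite_def inner_commute
        flip: vector_transpose_matrix)
  have pos: "0 < x \<bullet> (P *v x)" using P x by (auto simp: symmetric_positive_definite_def)
  define w where "w = (1 / sqrt (x \<bullet> (P *v x))) *\<^sub>R x"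
  have w: "w \<bullet> (P *v w) = 1"
    using pos unfolding w_def quadratic_form_scaleR by (simp add: power_divide)
  have wS: "w \<bullet> (P *v y) = 0" "y \<bullet> (P *v w) = 0" if "y \<in> S" for y
    using xS[OF that] sym[of y w] by (simp_all add: w_def)
  have "w \<notin> S" using wS w by force
  show ?case
    by (rule exI[of _ "insert w S"]) (use S on w wS \<open>w \<notin> S\<close> in auto)
qed

lemma orthonormalising_matrix:
  fixes P :: "real ^ 'n ^ 'n" and v :: "real ^ 'n"
  assumes P: "symmetric_positive_definite P" and v: "v \<bullet> (P *v v) = 1"
  obtains A :: "real ^ 'n ^ 'n" and i0 where "transpose A ** P ** A = mat 1" "A *v axis i0 1 = v"
proof -
  have "CARD('n) - 1 < CARD('n)" by simp
  from orthonormal_extension[OF P v this] obtain S where S: "v \<in> S" "finite S" "card S = CARD('n)"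
    and on: "\<And>x y. x \<in> S \<Longrightarrow> y \<in> S \<Longrightarrow> x \<bullet> (P *v y) = (if x = y then 1 else 0)"
    by auto
  obtain f :: "'n \<Rightarrow> real ^ 'n" where f: "bij_betw f UNIV S"
    using finite_same_card_bij[of "UNIV :: 'n set" S] S by auto
  define A :: "real ^ 'n ^ 'n" where "A = (\<chi> i j. f j $ i)"
  have col: "column j A = f j" for j by (simp add: A_def column_def vec_eq_iff)
  have Aax: "A *v axis j 1 = f j" for j by (simp add: matrix_vector_mult_basis col)
  have "(transpose A ** P ** A) $ i $ j = (mat 1 :: real ^ 'n ^ 'n) $ i $ j" for i j
  proof -
    have "(transpose A ** P ** A) $ i $ j = axis i 1 \<bullet> ((transpose A ** P ** A) *v axis j 1)"
      by (simp add: matrix_vector_mult_basis inner_axis' column_def)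
    also have "\<dots> = axis i 1 \<bullet> (transpose A *v (P *v f j))"
      by (simp add: Aax matrix_vector_mul_assoc[symmetric])
    also have "\<dots> = f i \<bullet> (P *v f j)"
      by (metis Aax dot_lmul_matrix vector_transpose_matrix transpose_transpose)
    also have "\<dots> = (if f i = f j then 1 else 0)"
      using f by (intro on) (auto simp: bij_betw_def)
    also have "\<dots> = (mat 1 :: real ^ 'n ^ 'n) $ i $ j"
      using f by (auto simp: mat_def bij_betw_def inj_def)
    finally show ?thesis .
  qed
  then have "transpose A ** P ** A = mat 1" by (simp add: vec_eq_iff)
  moreover obtain i0 where "f i0 = v" using f S by (auto simp: bij_betw_def)
  ultimately show ?thesis using that Aax by metis
qed

text \<open>
  Starting the orthonormal system at \<open>\<delta> / d\<close>, or at any unit vector if \<open>\<delta> = 0\<close>, makes \<open>\<delta>\<close> a multiple of one column of \<open>A\<close>, so that the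
  skewness acts on a single coordinate.
\<close>

lemma skew_elliptical_whitening:
  fixes \<Omega> :: "real ^ 'n ^ 'n" and \<delta> :: "real ^ 'n"
  assumes \<Omega>: "symmetric_positive_definite \<Omega>"
    and d: "d = sqrt (\<delta> \<bullet> (matrix_inv \<Omega> *v \<delta>))"
  obtains A :: "real ^ 'n ^ 'n" and i0 where
    "invertible A" "0 < det \<Omega>"
    "\<And>z. (A *v z) \<bullet> (matrix_inv \<Omega> *v (A *v z)) = z \<bullet> z"
    "\<And>z. \<delta> \<bullet> (matrix_inv \<Omega> *v (A *v z)) = d * z $ i0"
    "0 \<le> d"
proof -
  let ?P = "matrix_inv \<Omega>"
  note inv = symmetric_positive_definite_inverse(1)[OF \<Omega>]
  note P = symmetric_positive_definite_inverse(2)[OF \<Omega>]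
  have pos: "0 < x \<bullet> (?P *v x)" if "x \<noteq> 0" for x
    using P that by (auto simp: symmetric_positive_definite_def)
  obtain v where v: "v \<bullet> (?P *v v) = 1" "\<delta> = d *\<^sub>R v"
  proof (cases "\<delta> = 0")
    case True
    define x :: "real ^ 'n" where "x = axis undefined 1"
    have "x \<noteq> 0" by (simp add: x_def axis_eq_0_iff)
    from pos[OF this] have unit: "((1 / sqrt (x \<bullet> (?P *v x))) *\<^sub>R x) \<bullet> (?P *v ((1 / sqrt (x \<bullet> (?P *v x))) *\<^sub>R x)) = 1"
      unfolding quadratic_form_scaleR by (simp add: power_divide)
    show ?thesis by (rule that[OF unit]) (use True d in simp)
  next
    case False
    from pos[OF this] have "((1 / d) *\<^sub>R \<delta>) \<bullet> (?P *v ((1 / d) *\<^sub>R \<delta>)) = 1" "d \<noteq> 0"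
      unfolding quadratic_form_scaleR by (simp_all add: d power_divide)
    then show ?thesis by (intro that[of "(1 / d) *\<^sub>R \<delta>"]) auto
  qed
  obtain A :: "real ^ 'n ^ 'n" and i0 where A: "transpose A ** ?P ** A = mat 1" "A *v axis i0 1 = v"
    by (rule orthonormalising_matrix[OF P v(1)])
  have form: "(A *v y) \<bullet> (?P *v (A *v z)) = y \<bullet> z" for y z
  proof -
    have "(A *v y) \<bullet> (?P *v (A *v z)) = y \<bullet> ((transpose A ** ?P ** A) *v z)"
      by (metis dot_lmul_matrix matrix_vector_mul_assoc vector_transpose_matrix transpose_transpose)
    then show ?thesis by (simp add: A)
  qed
  show ?thesis
  proof (rule that)
    show "invertible A"
      using A(1) unfolding invertible_left_inverse by blast
    have "det A * det ?P * det A = 1"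
      using arg_cong[OF A(1), of det] by (simp add: det_mul)
    moreover have "det ?P * det \<Omega> = 1"
      using arg_cong[OF matrix_inv_left[OF inv], of det] by (simp add: det_mul)
    ultimately have det: "det \<Omega> = (det A)\<^sup>2" "det A \<noteq> 0"
      by (algebra, auto)
    then show "0 < det \<Omega>" by simp
    show "(A *v z) \<bullet> (?P *v (A *v z)) = z \<bullet> z" for z by (rule form)
    show "\<delta> \<bullet> (?P *v (A *v z)) = d * z $ i0" for z
      using form[of "axis i0 1" z] by (simp add: v(2) A inner_axis')
    show "0 \<le> d"
      using pos[of \<delta>] by (cases "\<delta> = 0") (auto simp: d)
  qed
qed

section \<open>Change of variables\<close>

lemma nn_integral_lborel_translation:
  fixes f :: "'e::euclidean_space \<Rightarrow> ennreal"
  assumes [measurable]: "f \<in> borel_measurable borel"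
  shows "(\<integral>\<^sup>+x. f (t + x) \<partial>lborel) = (\<integral>\<^sup>+x. f x \<partial>lborel)"
  by (subst (2) lborel_distr_plus[of t, symmetric]) (simp add: nn_integral_distr)

lemma matrix_vector_mult_measurable[measurable]:
  fixes A :: "real ^ 'n ^ 'm"
  shows "(*v) A \<in> borel_measurable borel"
  by (intro borel_measurable_continuous_onI matrix_vector_mult_linear_continuous_on)

lemma emeasure_unit_ball:
  "emeasure lborel (ball (0::'e::euclidean_space) 1) = ennreal (measure lborel (ball (0::'e) 1))"
  "emeasure lborel (cball (0::'e) 1) = ennreal (measure lborel (cball (0::'e) 1))"
  by (rule emeasure_eq_ennreal_measure, rule less_imp_neq[OF emeasure_bounded_finite, unfolded infinity_ennreal_def], simp)+

text \<open>
  Uniqueness of the translation-invariant measure, up to the constant \<open>c\<close>: with \<open>h\<close> the indicator of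
  the unit ball, integrate \<open>f (T z + x) * h (T z)\<close> over \<open>x\<close> and \<open>z\<close>.  Integrating over \<open>x\<close> first
  separates the factors, and so does shifting \<open>z\<close> by \<open>- S x\<close> first, which moves the shift from \<open>f\<close>
  to \<open>h\<close>.  The constant is \<open>1\<close> for an isometry; otherwise the total mass of a density
  will evaluate it.
\<close>

lemma nn_integral_linear_image:
  fixes T S :: "'e::euclidean_space \<Rightarrow> 'e"
  assumes T: "linear T" and TS: "\<And>x. T (S x) = x"
  obtains c :: real where "0 < c"
    "\<And>f. f \<in> borel_measurable borel \<Longrightarrow> (\<integral>\<^sup>+x. f x \<partial>lborel) = ennreal c * (\<integral>\<^sup>+z. f (T z) \<partial>lborel)"
proof -
  define h :: "'e \<Rightarrow> ennreal" where "h = indicator (ball 0 1)"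
  have [measurable]: "h \<in> borel_measurable borel" unfolding h_def by (rule borel_measurable_indicator) simp
  let ?K = "\<integral>\<^sup>+z. h (T z) \<partial>lborel" and ?V = "\<integral>\<^sup>+x. h x \<partial>lborel"
  have [measurable]: "T \<in> borel_measurable borel"
    using T by (intro borel_measurable_continuous_onI linear_continuous_on) (simp add: linear_conv_bounded_linear)
  have key: "(\<integral>\<^sup>+x. f x \<partial>lborel) * ?K = (\<integral>\<^sup>+z. f (T z) \<partial>lborel) * ?V"
    if f[measurable]: "f \<in> borel_measurable borel" for f
  proof -
    have "(\<integral>\<^sup>+x. f x \<partial>lborel) * ?K = (\<integral>\<^sup>+z. (\<integral>\<^sup>+x. f x \<partial>lborel) * h (T z) \<partial>lborel)"
      by (rule nn_integral_cmult[symmetric]) measurable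
    also have "\<dots> = (\<integral>\<^sup>+z. \<integral>\<^sup>+x. f (T z + x) * h (T z) \<partial>lborel \<partial>lborel)"
    proof (rule nn_integral_cong)
      fix z
      have "(\<integral>\<^sup>+x. f x \<partial>lborel) * h (T z) = (\<integral>\<^sup>+x. f (T z + x) \<partial>lborel) * h (T z)"
        by (simp add: nn_integral_lborel_translation)
      also have "\<dots> = (\<integral>\<^sup>+x. f (T z + x) * h (T z) \<partial>lborel)"
        by (rule nn_integral_multc[symmetric]) measurable
      finally show "(\<integral>\<^sup>+x. f x \<partial>lborel) * h (T z) = (\<integral>\<^sup>+x. f (T z + x) * h (T z) \<partial>lborel)" .
    qed
    also have "\<dots> = (\<integral>\<^sup>+x. \<integral>\<^sup>+z. f (T z + x) * h (T z) \<partial>lborel \<partial>lborel)"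
      by (rule lborel_pair.Fubini') measurable
    also have "\<dots> = (\<integral>\<^sup>+x. \<integral>\<^sup>+z. f (T z) * h (T z - x) \<partial>lborel \<partial>lborel)"
    proof (rule nn_integral_cong)
      fix x
      have "(\<integral>\<^sup>+z. f (T z + x) * h (T z) \<partial>lborel) = (\<integral>\<^sup>+z. f (T (- S x + z) + x) * h (T (- S x + z)) \<partial>lborel)"
        by (rule nn_integral_lborel_translation[symmetric]) measurable
      then show "(\<integral>\<^sup>+z. f (T z + x) * h (T z) \<partial>lborel) = (\<integral>\<^sup>+z. f (T z) * h (T z - x) \<partial>lborel)"
        by (simp add: linear_diff[OF T] TS)
    qed
    also have "\<dots> = (\<integral>\<^sup>+z. \<integral>\<^sup>+x. f (T z) * h (T z - x) \<partial>lborel \<partial>lborel)"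
      by (rule lborel_pair.Fubini') measurable
    also have "\<dots> = (\<integral>\<^sup>+z. f (T z) * ?V \<partial>lborel)"
    proof (rule nn_integral_cong)
      fix z
      have "(\<integral>\<^sup>+x. f (T z) * h (T z - x) \<partial>lborel) = f (T z) * (\<integral>\<^sup>+x. h (T z - x) \<partial>lborel)"
        by (rule nn_integral_cmult) measurable
      also have "(\<integral>\<^sup>+x. h (T z - x) \<partial>lborel) = (\<integral>\<^sup>+x. h (- T z + x) \<partial>lborel)"
        by (intro nn_integral_cong) (simp add: h_def indicator_def dist_norm norm_minus_commute)
      also have "\<dots> = ?V" by (rule nn_integral_lborel_translation) measurable
      finally show "(\<integral>\<^sup>+x. f (T z) * h (T z - x) \<partial>lborel) = f (T z) * ?V" .
    qed
    also have "\<dots> = (\<integral>\<^sup>+z. f (T z) \<partial>lborel) * ?V"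
      by (rule nn_integral_multc) measurable
    finally show ?thesis .
  qed
  have inj: "inj T"
  proof -
    have "surj T" using TS by (metis surjI)
    then show ?thesis using linear_surjective_imp_injective[OF T] by simp
  qed
  have V: "0 < measure lborel (ball (0::'e) 1)" "?V = ennreal (measure lborel (ball (0::'e) 1))"
    by (rule content_ball_pos, simp) (simp add: h_def emeasure_unit_ball)
  \<comment> \<open>The image of the closed ball is a test function that shows \<open>0 < ?K < \<infinity>\<close>.\<close>
  have "compact (T ` cball 0 1)"
    using T by (intro compact_continuous_image linear_continuous_on) (simp_all add: linear_conv_bounded_linear)
  then have cl[measurable]: "T ` cball 0 1 \<in> sets borel" by (simp add: borel_closed compact_imp_closed)
  have "(\<integral>\<^sup>+x. indicator (T ` cball 0 1) x \<partial>lborel) * ?K =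
    (\<integral>\<^sup>+z. indicator (T ` cball 0 1) (T z) \<partial>lborel) * ?V"
    by (rule key) measurable
  also have "(\<integral>\<^sup>+z. indicator (T ` cball 0 1) (T z) \<partial>lborel) = (\<integral>\<^sup>+z. indicator (cball (0::'e) 1) z \<partial>lborel)"
    by (intro nn_integral_cong) (auto simp: indicator_def inj_image_mem_iff[OF inj])
  also have "\<dots> = ennreal (measure lborel (cball (0::'e) 1))"
    by (simp add: emeasure_unit_ball)
  finally have eq: "(\<integral>\<^sup>+x. indicator (T ` cball 0 1) x \<partial>lborel) * ?K =
    ennreal (measure lborel (cball (0::'e) 1)) * ennreal (measure lborel (ball (0::'e) 1))"
    by (simp only: V(2))
  have cb: "0 < measure lborel (cball (0::'e) 1)"
    by (rule content_cball_pos) simp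
  have "?K \<noteq> 0" using eq cb V(1) by auto
  moreover have "?K \<noteq> \<infinity>"
  proof
    assume "?K = \<infinity>"
    define X where "X = (\<integral>\<^sup>+x. indicator (T ` cball 0 1) x \<partial>lborel)"
    have "X * \<infinity> = ennreal (measure lborel (cball (0::'e) 1) * measure lborel (ball (0::'e) 1))"
      using eq unfolding X_def[symmetric] \<open>?K = \<infinity>\<close> by (simp add: ennreal_mult)
    moreover have "0 < measure lborel (cball (0::'e) 1) * measure lborel (ball (0::'e) 1)"
      using cb V(1) by simp
    ultimately show False
      by (cases "X = 0") (auto simp: ennreal_mult_top simp del: zero_less_mult_iff)
  qed
  ultimately obtain \<kappa> where \<kappa>: "?K = ennreal \<kappa>" "0 < \<kappa>"
    by (cases ?K rule: ennreal_cases) (auto simp: less_le)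
  define c where "c = measure lborel (ball (0::'e) 1) / \<kappa>"
  show ?thesis
  proof (rule that[of c])
    show "0 < c" using V \<kappa> by (simp add: c_def)
    fix f :: "'e \<Rightarrow> ennreal" assume f: "f \<in> borel_measurable borel"
    have "(\<integral>\<^sup>+x. f x \<partial>lborel) = (\<integral>\<^sup>+x. f x \<partial>lborel) * ?K * ennreal (1 / \<kappa>)"
      using \<kappa> by (simp add: mult.assoc flip: ennreal_mult')
    also have "\<dots> = (\<integral>\<^sup>+z. f (T z) \<partial>lborel) * (ennreal (measure lborel (ball (0::'e) 1)) * ennreal (1 / \<kappa>))"
      by (simp only: key[OF f] V(2) mult.assoc)
    also have "\<dots> = ennreal c * (\<integral>\<^sup>+z. f (T z) \<partial>lborel)"
      using \<kappa> by (simp add: c_def mult.commute flip: ennreal_mult')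
    finally show "(\<integral>\<^sup>+x. f x \<partial>lborel) = ennreal c * (\<integral>\<^sup>+z. f (T z) \<partial>lborel)" .
  qed
qed

lemma nn_integral_linear_isometry:
  fixes T S :: "'e::euclidean_space \<Rightarrow> 'e"
  assumes T: "linear T" and TS: "\<And>x. T (S x) = x" and iso: "\<And>x. T x \<bullet> T x = x \<bullet> x"
    and f: "f \<in> borel_measurable borel"
  shows "(\<integral>\<^sup>+x. f (T x) \<partial>lborel) = (\<integral>\<^sup>+x. f x \<partial>lborel)"
proof -
  obtain c :: real where c: "0 < c"
    "\<And>f. f \<in> borel_measurable borel \<Longrightarrow> (\<integral>\<^sup>+x. f x \<partial>lborel) = ennreal c * (\<integral>\<^sup>+z. f (T z) \<partial>lborel)"
    by (rule nn_integral_linear_image[OF T TS]) blast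
  define V where "V = measure lborel (ball (0::'e) 1)"
  have V: "0 < V" "emeasure lborel (ball (0::'e) 1) = ennreal V"
    unfolding V_def by (rule content_ball_pos, simp) (rule emeasure_unit_ball)
  have "norm (T z) = norm z" for z by (simp add: norm_eq_sqrt_inner iso)
  then have "indicator (ball (0::'e) 1) (T z) = (indicator (ball 0 1) z :: ennreal)" for z
    by (simp add: indicator_def)
  moreover have "(indicator (ball (0::'e) 1) :: 'e \<Rightarrow> ennreal) \<in> borel_measurable borel"
    by (rule borel_measurable_indicator) simp
  ultimately have "(\<integral>\<^sup>+x. indicator (ball (0::'e) 1) x \<partial>lborel) = ennreal c * (\<integral>\<^sup>+z. indicator (ball (0::'e) 1) z \<partial>lborel)"
    using c(2)[of "indicator (ball 0 1)"] by simp
  then have "ennreal V = ennreal (c * V)" using c(1) V by (simp add: ennreal_mult')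
  then have "c = 1" using V c(1) by simp
  then show ?thesis using c(2)[OF f] by simp
qed

text \<open>
  For \<open>d\<^sup>2 + s\<^sup>2 = 1\<close>, in the plane of the first coordinate and the coordinate \<open>i\<close> this is the reflection that carries
  the half-space \<open>0 < u\<close> onto \<open>s * r < d * z $ i\<close>; the other coordinates are fixed.
\<close>

definition plane_reflection :: "real \<Rightarrow> real \<Rightarrow> 'n \<Rightarrow> real \<times> (real ^ 'n) \<Rightarrow> real \<times> (real ^ 'n)" where
  "plane_reflection d s i x =
     (d * snd x $ i - s * fst x, snd x + (d * fst x + (s - 1) * snd x $ i) *\<^sub>R axis i 1)"

lemma plane_reflection_coordinate:
  "snd (plane_reflection d s i x) $ j = (if j = i then d * fst x + s * snd x $ i else snd x $ j)"
  by (auto simp: plane_reflection_def axis_def algebra_simps)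

lemma plane_reflection_measurable:
  "(\<lambda>x. snd (plane_reflection d s i x)) \<in> borel_measurable borel"
  unfolding plane_reflection_def[abs_def] snd_conv
  by (intro borel_measurable_continuous_onI continuous_intros)

lemma plane_reflection_inner:
  assumes "d\<^sup>2 + s\<^sup>2 = 1"
  shows "plane_reflection d s i x \<bullet> plane_reflection d s i x = x \<bullet> x"
proof -
  let ?y = "plane_reflection d s i x"
  have split: "z \<bullet> z = z $ i * z $ i + (\<Sum>j\<in>UNIV - {i}. z $ j * z $ j)" for z :: "real ^ 'a"
    by (simp add: inner_vec_def sum.remove[of UNIV i])
  have "fst ?y * fst ?y + snd ?y $ i * snd ?y $ i = (d\<^sup>2 + s\<^sup>2) * (fst x * fst x + snd x $ i * snd x $ i)"
    unfolding plane_reflection_coordinate by (simp add: plane_reflection_def power2_eq_square algebra_simps)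
  then show ?thesis
    using assms by (simp add: inner_prod_def split[of "snd x"] split[of "snd ?y"] plane_reflection_coordinate)
qed

text \<open>
  A reflection is an isometry and its own inverse.
\<close>

lemma nn_integral_plane_reflection:
  fixes f :: "real \<times> (real ^ 'n) \<Rightarrow> ennreal"
  assumes f: "f \<in> borel_measurable borel" and ds: "d\<^sup>2 + s\<^sup>2 = 1"
  shows "(\<integral>\<^sup>+x. f (plane_reflection d s i x) \<partial>lborel) = (\<integral>\<^sup>+x. f x \<partial>lborel)"
proof -
  have lin: "linear (plane_reflection d s i)"
    by (rule linearI) (auto simp: plane_reflection_def algebra_simps)
  have invol: "plane_reflection d s i (plane_reflection d s i x) = x" for x
  proof (rule prod_eqI)
    have "fst (plane_reflection d s i (plane_reflection d s i x)) = (d\<^sup>2 + s\<^sup>2) * fst x"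
      by (subst plane_reflection_def, simp add: plane_reflection_coordinate)
        (simp add: plane_reflection_def power2_eq_square algebra_simps)
    then show "fst (plane_reflection d s i (plane_reflection d s i x)) = fst x" by (simp add: ds)
    have "d * fst (plane_reflection d s i x) + s * snd (plane_reflection d s i x) $ i = (d\<^sup>2 + s\<^sup>2) * snd x $ i"
      by (simp add: plane_reflection_coordinate) (simp add: plane_reflection_def power2_eq_square algebra_simps)
    then show "snd (plane_reflection d s i (plane_reflection d s i x)) = snd x"
      by (auto simp: vec_eq_iff plane_reflection_coordinate ds)
  qed
  show ?thesis
    by (rule nn_integral_linear_isometry[OF lin invol plane_reflection_inner[OF ds] f])
qed

text \<open>
  The substitution \<open>y = \<mu> + A z\<close> makes the density spherical in \<open>(r, z)\<close>, cut off by the half-space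
  \<open>s * r < d * z $ i0\<close>, which the reflection moves into standard position.  This determines the law up
  to a constant, and both sides have total mass one.
\<close>

lemma skew_elliptical_law:
  fixes \<mu> \<delta> :: "real ^ 'n" and \<Omega> A :: "real ^ 'n ^ 'n" and i0 :: 'n
  assumes f[measurable]: "skew_elliptical_density \<mu> \<Omega> \<delta> g \<in> borel_measurable borel"
    and g[measurable]: "(\<lambda>x::real \<times> (real ^ 'n). g (x \<bullet> x)) \<in> borel_measurable borel" and g0: "\<And>t. 0 \<le> t \<Longrightarrow> 0 \<le> g t"
    and ds: "d\<^sup>2 + s\<^sup>2 = 1" "0 < s" "s = sqrt (1 - \<delta> \<bullet> (matrix_inv \<Omega> *v \<delta>))"
    and prob: "prob_space (density lborel (skew_elliptical_density \<mu> \<Omega> \<delta> g))"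
      "prob_space (density lborel (\<lambda>x::real \<times> (real ^ 'n). ennreal (2 * half_power 0 (x \<bullet> (1, 0)) * g (x \<bullet> x))))"
    and \<Omega>: "0 < det \<Omega>"
    and A: "invertible A"
    "\<And>z. (A *v z) \<bullet> (matrix_inv \<Omega> *v (A *v z)) = z \<bullet> z"
    "\<And>z. \<delta> \<bullet> (matrix_inv \<Omega> *v (A *v z)) = d * z $ i0"
  shows "density lborel (skew_elliptical_density \<mu> \<Omega> \<delta> g) =
    distr (density lborel (\<lambda>x. ennreal (2 * half_power 0 (x \<bullet> (1, 0)) * g (x \<bullet> x)))) borel
      (\<lambda>x. \<mu> + A *v snd (plane_reflection d s i0 x))"
    (is "?L = distr ?H borel ?T")
proof -
  have [measurable]: "half_power 0 \<in> borel_measurable borel" by (rule half_power.measurable_weight)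
  have [measurable]: "?T \<in> borel_measurable borel"
    by (intro borel_measurable_add borel_measurable_const
        measurable_compose[OF plane_reflection_measurable matrix_vector_mult_measurable])
  have linA: "linear ((*v) A)"
    by (rule matrix_vector_mul_linear)
  have invA: "A *v (matrix_inv A *v x) = x" for x
    by (simp add: matrix_vector_mul_assoc matrix_inv_right[OF A(1)])
  obtain c :: real where c: "0 < c"
    "\<And>f. f \<in> borel_measurable borel \<Longrightarrow> (\<integral>\<^sup>+x. f x \<partial>lborel) = ennreal c * (\<integral>\<^sup>+z. f (A *v z) \<partial>lborel)"
    by (rule nn_integral_linear_image[OF linA invA]) blast
  define C where "C = c * det \<Omega> powr (- 1 / 2)"
  have C: "0 < C" using c(1) \<Omega> by (simp add: C_def)
  have scaled: "emeasure ?L B = ennreal C * emeasure (distr ?H borel ?T) B" if B[measurable]: "B \<in> sets borel" for B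
  proof -
  define F :: "real \<times> (real ^ 'n) \<Rightarrow> ennreal" where
    "F x = ennreal (2 * half_power 0 (d * snd x $ i0 - s * fst x) * g (x \<bullet> x)) * indicator B (\<mu> + A *v snd x)" for x
  have [measurable]: "F \<in> borel_measurable borel"
  proof -
    have 1: "(\<lambda>x::real \<times> (real ^ 'n). d * snd x $ i0 - s * fst x) \<in> borel_measurable borel"
      by (intro borel_measurable_continuous_onI continuous_intros)
    have "(\<lambda>x::real \<times> (real ^ 'n). \<mu> + A *v snd x) \<in> borel_measurable borel"
      by (intro borel_measurable_add borel_measurable_const measurable_compose[OF _ matrix_vector_mult_measurable]
        borel_measurable_continuous_onI continuous_intros)
    from measurable_compose[OF this borel_measurable_indicator[OF B]] g
      measurable_compose[OF 1 half_power.measurable_weight[of 0]]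
    show ?thesis unfolding F_def[abs_def]
      by (intro borel_measurable_times_ennreal measurable_compose[OF _ measurable_ennreal] borel_measurable_times borel_measurable_const)
  qed
  have Fp[measurable]: "F \<in> borel_measurable (borel \<Otimes>\<^sub>M borel)" by (simp add: borel_prod)
  have inner: "ennreal c * (skew_elliptical_density \<mu> \<Omega> \<delta> g (\<mu> + A *v z) * indicator B (\<mu> + A *v z)) =
    ennreal C * (\<integral>\<^sup>+r. F (r, z) \<partial>lborel)" for z
  proof -
    have lim: "skewness_vector \<Omega> \<delta> \<bullet> (A *v z) = d * z $ i0 / s"
      using A(3)[of z] by (simp add: skewness_vector_def ds(3) dot_lmul_matrix)
    have gm: "(\<lambda>r. ennreal (g (r\<^sup>2 + z \<bullet> z))) \<in> borel_measurable borel"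
    proof -
      have "(\<lambda>r. (r, z)) \<in> borel_measurable (borel :: real measure)"
        by (intro borel_measurable_continuous_onI continuous_intros)
      from measurable_compose[OF measurable_compose[OF this g] measurable_ennreal]
      have "(\<lambda>r::real. ennreal (g ((r, z) \<bullet> (r, z)))) \<in> borel_measurable borel" .
      then show ?thesis by (simp add: power2_eq_square)
    qed
    have "ennreal c * skew_elliptical_density \<mu> \<Omega> \<delta> g (\<mu> + A *v z) =
      ennreal (c * (2 * det \<Omega> powr (- 1 / 2))) *
      (\<integral>\<^sup>+r\<in>{..d * z $ i0 / s}. ennreal (g (r\<^sup>2 + z \<bullet> z)) \<partial>lborel)"
    proof -
      have "ennreal (c * (2 * det \<Omega> powr (- 1 / 2))) = ennreal c * ennreal (2 * det \<Omega> powr (- 1 / 2))"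
        by (rule ennreal_mult) (use c(1) in auto)
      then show ?thesis
        by (simp only: skew_elliptical_density_def add_diff_cancel_left' A(2) lim mult.assoc)
    qed
    also have "c * (2 * det \<Omega> powr (- 1 / 2)) = C * 2"
      by (simp add: C_def)
    finally have "ennreal c * (skew_elliptical_density \<mu> \<Omega> \<delta> g (\<mu> + A *v z) * indicator B (\<mu> + A *v z)) =
      ennreal (C * 2) * (\<integral>\<^sup>+r\<in>{..d * z $ i0 / s}. ennreal (g (r\<^sup>2 + z \<bullet> z)) \<partial>lborel) * indicator B (\<mu> + A *v z)"
      by (simp add: mult.assoc[symmetric])
    also have "\<dots> = ennreal C * (\<integral>\<^sup>+r. ennreal 2 * (ennreal (g (r\<^sup>2 + z \<bullet> z)) * indicator {..d * z $ i0 / s} r) * indicator B (\<mu> + A *v z) \<partial>lborel)"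
      using gm C by (subst nn_integral_multc, measurable, subst nn_integral_cmult, measurable)
        (simp add: ennreal_mult' mult.assoc)
    also have "(\<integral>\<^sup>+r. ennreal 2 * (ennreal (g (r\<^sup>2 + z \<bullet> z)) * indicator {..d * z $ i0 / s} r) * indicator B (\<mu> + A *v z) \<partial>lborel)
      = (\<integral>\<^sup>+r. F (r, z) \<partial>lborel)"
    proof (rule nn_integral_cong_AE)
      \<comment> \<open>The density includes the boundary of the half-space, \<open>half_power 0\<close> does not.\<close>
      have "AE r in lborel. r \<noteq> d * z $ i0 / s" by (rule AE_lborel_singleton)
      then show "AE r in lborel. ennreal 2 * (ennreal (g (r\<^sup>2 + z \<bullet> z)) * indicator {..d * z $ i0 / s} r) * indicator B (\<mu> + A *v z) = F (r, z)"
      proof eventually_elim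
        case (elim r)
        then have "r \<le> d * z $ i0 / s \<longleftrightarrow> 0 < d * z $ i0 - s * r"
          using ds(2) by (auto simp: field_simps)
        moreover have "0 \<le> g (r\<^sup>2 + z \<bullet> z)" by (intro g0) auto
        ultimately show ?case
          by (auto simp: F_def half_power_def indicator_def power2_eq_square ennreal_mult')
      qed
    qed
    finally show ?thesis .
  qed
  have "emeasure ?L B = (\<integral>\<^sup>+y. skew_elliptical_density \<mu> \<Omega> \<delta> g y * indicator B y \<partial>lborel)"
    by (rule emeasure_density) auto
  also have "\<dots> = (\<integral>\<^sup>+y. skew_elliptical_density \<mu> \<Omega> \<delta> g (\<mu> + y) * indicator B (\<mu> + y) \<partial>lborel)"
    by (rule nn_integral_lborel_translation[symmetric]) measurable
  also have "\<dots> = ennreal c * (\<integral>\<^sup>+z. skew_elliptical_density \<mu> \<Omega> \<delta> g (\<mu> + A *v z) * indicator B (\<mu> + A *v z) \<partial>lborel)"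
    by (rule c(2)) measurable
  also have "\<dots> = (\<integral>\<^sup>+z. ennreal c * (skew_elliptical_density \<mu> \<Omega> \<delta> g (\<mu> + A *v z) * indicator B (\<mu> + A *v z)) \<partial>lborel)"
    by (rule nn_integral_cmult[symmetric]) measurable
  also have "\<dots> = ennreal C * (\<integral>\<^sup>+z. \<integral>\<^sup>+r. F (r, z) \<partial>lborel \<partial>lborel)"
    unfolding inner by (rule nn_integral_cmult) measurable
  also have "(\<integral>\<^sup>+z. \<integral>\<^sup>+r. F (r, z) \<partial>lborel \<partial>lborel) = (\<integral>\<^sup>+x. F x \<partial>lborel)"
    by (subst lborel_prod[symmetric], subst lborel_pair.nn_integral_snd) auto
  also have "(\<integral>\<^sup>+x. F x \<partial>lborel) = (\<integral>\<^sup>+x. F (plane_reflection d s i0 x) \<partial>lborel)"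
    by (rule nn_integral_plane_reflection[symmetric]) (use ds in auto)
  also have "(\<integral>\<^sup>+x. F (plane_reflection d s i0 x) \<partial>lborel) = (\<integral>\<^sup>+x. ennreal (2 * half_power 0 (x \<bullet> (1, 0)) * g (x \<bullet> x)) * indicator (?T -` B) x \<partial>lborel)"
  proof (rule nn_integral_cong)
    fix x :: "real \<times> (real ^ 'n)"
    have "d * snd (plane_reflection d s i0 x) $ i0 - s * fst (plane_reflection d s i0 x) = (d\<^sup>2 + s\<^sup>2) * fst x"
      by (simp add: plane_reflection_coordinate) (simp add: plane_reflection_def power2_eq_square algebra_simps)
    then show "F (plane_reflection d s i0 x) = ennreal (2 * half_power 0 (x \<bullet> (1, 0)) * g (x \<bullet> x)) * indicator (?T -` B) x"
      by (simp add: F_def plane_reflection_inner ds(1) inner_prod_def[of x "(1, 0)"] indicator_def)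
  qed
  also have "(\<integral>\<^sup>+x. ennreal (2 * half_power 0 (x \<bullet> (1, 0)) * g (x \<bullet> x)) * indicator (?T -` B) x \<partial>lborel) = emeasure ?H (?T -` B)"
    by (rule emeasure_density[symmetric]) (auto intro: measurable_sets_borel[of ?T borel])
  also have "emeasure ?H (?T -` B) = emeasure (distr ?H borel ?T) B"
    by (subst emeasure_distr) auto
  finally show ?thesis .
  qed
  have "prob_space (distr ?H borel ?T)"
    by (rule prob_space.prob_space_distr[OF prob(2)]) simp
  then have "emeasure (distr ?H borel ?T) UNIV = 1"
    using prob_space.emeasure_space_1 by fastforce
  moreover have "emeasure ?L UNIV = 1"
    using prob_space.emeasure_space_1[OF prob(1)] by simp
  \<comment> \<open>Comparing total masses evaluates \<open>c * det \<Omega> powr (- 1 / 2)\<close>.\<close>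
  ultimately have "ennreal C = 1"
    using scaled[of UNIV] by simp
  then show ?thesis
    using scaled by (intro measure_eqI) auto
qed

section \<open>The Mardia measure in uncorrelated coordinates\<close>

lemma (in prob_space) has_bochner_integral_square_product:
  fixes f :: "'a \<Rightarrow> real"
  assumes f: "integrable M f"
  shows "has_bochner_integral (M \<Otimes>\<^sub>M M) (\<lambda>(x, y). f x * f y) ((\<integral>x. f x \<partial>M)\<^sup>2)"
proof -
  interpret P: pair_sigma_finite M M ..
  have [measurable]: "f \<in> borel_measurable M" using f by auto
  have int: "integrable (M \<Otimes>\<^sub>M M) (\<lambda>(x, y). f x * f y)"
    by (rule P.Fubini_integrable) (use f in \<open>auto simp: abs_mult integrable_abs\<close>)
  have "(\<integral>z. (\<lambda>(x, y). f x * f y) z \<partial>(M \<Otimes>\<^sub>M M)) = (\<integral>x. (\<integral>y. f x * f y \<partial>M) \<partial>M)"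
    using P.integral_fst'[OF int] by simp
  also have "\<dots> = (\<integral>x. f x \<partial>M)\<^sup>2"
    by (simp add: power2_eq_square)
  finally show ?thesis
    using int by (simp add: has_bochner_integral_iff)
qed

lemma bounded_linear_matrix_vector_mult: "bounded_linear ((*v) (A :: real ^ 'n ^ 'm))"
  by (simp flip: linear_conv_bounded_linear)

text \<open>
  The matrix \<open>A\<close> cancels in the quadratic form, which leaves \<open>\<Sum>i. W i * W' i / \<sigma> i\<close> for independent
  copies \<open>W\<close> and \<open>W'\<close>.  Expanding its cube, each term is a product of a function of \<open>W\<close> and the same
  function of \<open>W'\<close>, so its mean is a squared third moment.
\<close>

lemma mardia_skewness_affine:
  fixes W :: "'a \<Rightarrow> real ^ 'n" and A :: "real ^ 'n ^ 'n" and \<xi> :: "real ^ 'n" and \<sigma> :: "'n \<Rightarrow> real"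
  assumes Q: "prob_space Q" and W[measurable]: "W \<in> borel_measurable Q"
    and A: "invertible A"
    and int1: "\<And>i. integrable Q (\<lambda>x. W x $ i)"
    and int2: "\<And>i j. integrable Q (\<lambda>x. W x $ i * W x $ j)"
    and int3: "\<And>i j l. integrable Q (\<lambda>x. W x $ i * W x $ j * W x $ l)"
    and mean: "\<And>i. (\<integral>x. W x $ i \<partial>Q) = 0"
    and cov: "\<And>i j. (\<integral>x. W x $ i * W x $ j \<partial>Q) = (if i = j then \<sigma> i else 0)"
    and \<sigma>: "\<And>i. \<sigma> i \<noteq> 0"
  shows "mardia_skewness (distr Q borel (\<lambda>x. \<xi> + A *v W x)) =
    (\<Sum>i\<in>UNIV. \<Sum>j\<in>UNIV. \<Sum>l\<in>UNIV. (\<integral>x. W x $ i * W x $ j * W x $ l \<partial>Q)\<^sup>2 / (\<sigma> i * \<sigma> j * \<sigma> l))"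
proof -
  interpret Q: prob_space Q by fact
  define Y where "Y x = \<xi> + A *v W x" for x
  define F where "F = distr Q borel Y"
  have [measurable]: "Y \<in> borel_measurable Q"
    unfolding Y_def[abs_def] by measurable
  have "has_bochner_integral Q (\<lambda>x. \<Sum>i\<in>UNIV. W x $ i *\<^sub>R axis i (1::real)) (\<Sum>i\<in>UNIV. 0 *\<^sub>R axis i (1::real) :: real ^ 'n)"
    by (intro has_bochner_integral_sum has_bochner_integral_scaleR_left)
      (simp add: has_bochner_integral_iff int1 mean)
  moreover have "(\<Sum>i\<in>UNIV. W x $ i *\<^sub>R axis i (1::real)) = W x" for x
    using basis_expansion[of "W x"] by (simp add: scalar_mult_eq_scaleR)
  ultimately have "has_bochner_integral Q W 0" by simp
  from has_bochner_integral_bounded_linear[OF bounded_linear_matrix_vector_mult this]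
  have "has_bochner_integral Q (\<lambda>x. A *v W x) 0" by simp
  then have "(\<integral>x. Y x \<partial>Q) = \<xi>"
    by (simp add: Y_def[abs_def] has_bochner_integral_iff Q.prob_space)
  then have mv: "mean_vector F = \<xi>"
    unfolding mean_vector_def F_def by (subst integral_distr) auto
  define D :: "real ^ 'n ^ 'n" where "D = (\<chi> i j. if i = j then \<sigma> i else 0)"
  define D' :: "real ^ 'n ^ 'n" where "D' = (\<chi> i j. if i = j then 1 / \<sigma> i else 0)"
  have Dv: "D *v z = (\<chi> i. \<sigma> i * z $ i)" "D' *v z = (\<chi> i. z $ i / \<sigma> i)" for z
    by (simp_all add: D_def D'_def matrix_vector_mult_def vec_eq_iff if_distrib if_distribR cong: if_cong)
  have cv: "covariance_matrix F = A ** D ** transpose A"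
  proof -
    have "covariance_matrix F $ i $ j = (A ** D ** transpose A) $ i $ j" for i j
    proof -
      have "covariance_matrix F $ i $ j = (\<integral>x. (Y x $ i - \<xi> $ i) * (Y x $ j - \<xi> $ j) \<partial>Q)"
        unfolding covariance_matrix_def mv unfolding F_def by (simp add: integral_distr)
      also have "\<dots> = (\<integral>x. (\<Sum>m\<in>UNIV. \<Sum>l\<in>UNIV. A $ i $ m * A $ j $ l * (W x $ m * W x $ l)) \<partial>Q)"
        by (simp add: Y_def matrix_vector_mult_def sum_product mult_ac)
      also have "\<dots> = (\<Sum>m\<in>UNIV. \<Sum>l\<in>UNIV. A $ i $ m * A $ j $ l * (if m = l then \<sigma> m else 0))"
        by (simp add: Bochner_Integration.integral_sum int2 cov)
      also have "\<dots> = (\<Sum>m\<in>UNIV. A $ i $ m * \<sigma> m * A $ j $ m)"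
        by (simp add: if_distrib mult_ac cong: if_cong)
      also have "\<dots> = (A ** D ** transpose A) $ i $ j"
        by (simp add: matrix_matrix_mult_def D_def transpose_def if_distrib cong: if_cong)
      finally show ?thesis .
    qed
    then show ?thesis by (simp add: vec_eq_iff)
  qed
  have DD': "D *v (D' *v z) = z" for z by (simp add: Dv \<sigma> vec_eq_iff)
  have invD: "invertible D"
    unfolding invertible_right_inverse
    by (rule exI[of _ D']) (simp add: matrix_eq DD' flip: matrix_vector_mul_assoc)
  have invC: "invertible (A ** D ** transpose A)"
    by (intro invertible_mult A invD transpose_invertible)
  have TA: "transpose A *v (transpose (matrix_inv A) *v z) = z" for z
  proof -
    have "transpose A ** transpose (matrix_inv A) = mat 1"
      by (simp add: matrix_inv_left[OF A] flip: matrix_transpose_mul)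
    then show ?thesis by (metis matrix_vector_mul_assoc matrix_vector_mul_lid)
  qed
  have form: "(A *v w) \<bullet> (matrix_inv (covariance_matrix F) *v (A *v z)) = (\<Sum>i\<in>UNIV. w $ i * z $ i / \<sigma> i)" for w z
  proof -
    define y where "y = transpose (matrix_inv A) *v (D' *v z)"
    have "(A ** D ** transpose A) *v y = A *v (D *v (transpose A *v y))"
      by (simp only: matrix_vector_mul_assoc matrix_mul_assoc)
    also have "\<dots> = A *v z"
      unfolding y_def TA DD' ..
    finally have "matrix_inv (covariance_matrix F) *v (A *v z) = y"
      unfolding cv by (metis matrix_vector_mul_assoc matrix_inv_left[OF invC] matrix_vector_mul_lid)
    moreover have "(A *v w) \<bullet> y = (matrix_inv A *v (A *v w)) \<bullet> (D' *v z)"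
      unfolding y_def by (metis dot_lmul_matrix inner_commute transpose_transpose vector_transpose_matrix)
    moreover have "matrix_inv A *v (A *v w) = w"
      by (simp add: matrix_vector_mul_assoc matrix_inv_left[OF A])
    ultimately show ?thesis by (simp add: Dv inner_vec_def)
  qed
  have "mardia_skewness F = (\<integral>(x, y). (\<Sum>i\<in>UNIV. W x $ i * W y $ i / \<sigma> i) ^ 3 \<partial>(Q \<Otimes>\<^sub>M Q))"
  proof -
    have sf: "sigma_finite_measure (distr Q borel Y)"
      by (rule prob_space_imp_sigma_finite, rule Q.prob_space_distr) simp
    have FF: "F \<Otimes>\<^sub>M F = distr (Q \<Otimes>\<^sub>M Q) (borel \<Otimes>\<^sub>M borel) (\<lambda>(x, y). (Y x, Y y))"
      unfolding F_def by (rule pair_measure_distr) (auto intro: sf)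
    have "mardia_skewness F = (\<integral>(x, y). ((Y x - \<xi>) \<bullet> (matrix_inv (covariance_matrix F) *v (Y y - \<xi>))) ^ 3 \<partial>(Q \<Otimes>\<^sub>M Q))"
      unfolding mardia_skewness_def mv FF
    proof (subst integral_distr)
      show "(\<lambda>(x, y). ((x - \<xi>) \<bullet> (matrix_inv (covariance_matrix F) *v (y - \<xi>))) ^ 3) \<in> borel_measurable (borel \<Otimes>\<^sub>M borel)"
        using matrix_vector_mult_measurable[of "matrix_inv (covariance_matrix F)"] by measurable
    qed (auto simp: case_prod_beta')
    also have "\<dots> = (\<integral>(x, y). (\<Sum>i\<in>UNIV. W x $ i * W y $ i / \<sigma> i) ^ 3 \<partial>(Q \<Otimes>\<^sub>M Q))"
      by (simp add: Y_def form)
    finally show ?thesis .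
  qed
  also have "\<dots> = (\<integral>z. (\<Sum>i\<in>UNIV. \<Sum>j\<in>UNIV. \<Sum>l\<in>UNIV.
      (1 / (\<sigma> i * \<sigma> j * \<sigma> l)) * (\<lambda>(x, y). (W x $ i * W x $ j * W x $ l) * (W y $ i * W y $ j * W y $ l)) z) \<partial>(Q \<Otimes>\<^sub>M Q))"
    by (intro Bochner_Integration.integral_cong refl)
      (auto simp: power3_eq_cube sum_product sum_distrib_left sum_distrib_right sum_divide_distrib mult_ac)
  also have "\<dots> = (\<Sum>i\<in>UNIV. \<Sum>j\<in>UNIV. \<Sum>l\<in>UNIV. (1 / (\<sigma> i * \<sigma> j * \<sigma> l)) * (\<integral>x. W x $ i * W x $ j * W x $ l \<partial>Q)\<^sup>2)"
    by (intro has_bochner_integral_integral_eq has_bochner_integral_sum has_bochner_integral_mult_right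
        Q.has_bochner_integral_square_product int3)
  finally show ?thesis by (simp add: F_def Y_def[abs_def])
qed

text \<open>
  The index triples with nonzero summand are \<open>(e, e, e)\<close> and, for every \<open>w \<noteq> e\<close>, the three
  placements of one \<open>e\<close> among two copies of \<open>w\<close>.
\<close>

lemma mardia_sum:
  fixes \<tau> :: "'n::finite \<Rightarrow> 'n \<Rightarrow> 'n \<Rightarrow> real" and \<sigma> :: "'n \<Rightarrow> real"
  assumes eee: "\<tau> e e e = A"
    and eww: "\<And>w. w \<noteq> e \<Longrightarrow> \<tau> e w w = B" "\<And>w. w \<noteq> e \<Longrightarrow> \<tau> w e w = B" "\<And>w. w \<noteq> e \<Longrightarrow> \<tau> w w e = B"
    and zero: "\<And>i j l. \<not> (i = e \<and> j = l) \<Longrightarrow> \<not> (j = e \<and> i = l) \<Longrightarrow> \<not> (l = e \<and> i = j) \<Longrightarrow> \<tau> i j l = 0"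
    and \<sigma>: "\<And>i. \<sigma> i = (if i = e then v else b)"
  shows "(\<Sum>i\<in>UNIV. \<Sum>j\<in>UNIV. \<Sum>l\<in>UNIV. (\<tau> i j l)\<^sup>2 / (\<sigma> i * \<sigma> j * \<sigma> l)) =
    A\<^sup>2 / v ^ 3 + 3 * (real CARD('n) - 1) * B\<^sup>2 / (b\<^sup>2 * v)"
proof -
  define t where "t i j l = (\<tau> i j l)\<^sup>2 / (\<sigma> i * \<sigma> j * \<sigma> l)" for i j l
  let ?U = "UNIV - {e}"
  have split: "(\<Sum>i\<in>UNIV. f i) = f e + (\<Sum>i\<in>?U. f i)" for f :: "'n \<Rightarrow> real"
    by (rule sum.remove) auto
  have card: "real (card ?U) = real CARD('n) - 1"
    by (simp add: card_Diff_singleton of_nat_diff)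
  define q where "q = B\<^sup>2 / (b\<^sup>2 * v)"
  have t: "t e e e = A\<^sup>2 / v ^ 3" "\<And>w. w \<noteq> e \<Longrightarrow> t e w w = q" "\<And>w. w \<noteq> e \<Longrightarrow> t w e w = q" "\<And>w. w \<noteq> e \<Longrightarrow> t w w e = q"
    "\<And>i j l. \<not> (i = e \<and> j = l) \<Longrightarrow> \<not> (j = e \<and> i = l) \<Longrightarrow> \<not> (l = e \<and> i = j) \<Longrightarrow> t i j l = 0"
    using eee eww zero by (simp_all add: t_def q_def \<sigma> power2_eq_square power3_eq_cube mult_ac)
  have row_e: "(\<Sum>j\<in>UNIV. \<Sum>l\<in>UNIV. t e j l) = A\<^sup>2 / v ^ 3 + real (card ?U) * q"
  proof -
    have off: "t e j l = 0" if "l \<noteq> j" for j l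
      by (rule t(5)) (use that in auto)
    have "(\<Sum>l\<in>UNIV. t e j l) = t e j j" for j
      by (rule sum.mono_neutral_right[of UNIV "{j}", simplified]) (use off in auto)
    then have "(\<Sum>j\<in>UNIV. \<Sum>l\<in>UNIV. t e j l) = t e e e + (\<Sum>j\<in>?U. t e j j)" by (simp add: split)
    then show ?thesis using t(1,2) by simp
  qed
  have row_i: "(\<Sum>j\<in>UNIV. \<Sum>l\<in>UNIV. t i j l) = 2 * q" if i: "i \<noteq> e" for i
  proof -
    have "(\<Sum>l\<in>UNIV. t i e l) = t i e i"
      by (rule sum.mono_neutral_right[of UNIV "{i}", simplified]) (use t(5) i in auto)
    moreover have "(\<Sum>l\<in>UNIV. t i i l) = t i i e"
      by (rule sum.mono_neutral_right[of UNIV "{e}", simplified]) (use t(5) i in auto)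
    moreover have "(\<Sum>j\<in>UNIV. \<Sum>l\<in>UNIV. t i j l) = (\<Sum>j\<in>{e, i}. \<Sum>l\<in>UNIV. t i j l)"
    proof (rule sum.mono_neutral_right)
      show "\<forall>j\<in>UNIV - {e, i}. (\<Sum>l\<in>UNIV. t i j l) = 0"
        by (intro ballI sum.neutral t(5)) (use i in auto)
    qed auto
    ultimately show ?thesis using i t(3,4) by simp
  qed
  have "(\<Sum>i\<in>UNIV. \<Sum>j\<in>UNIV. \<Sum>l\<in>UNIV. t i j l) = A\<^sup>2 / v ^ 3 + 3 * (real (card ?U) * q)"
    by (subst split) (simp add: row_e row_i)
  then show ?thesis by (simp add: t_def card q_def)
qed

section \<open>The skewness of a skew-elliptical law\<close>

abbreviation radial_axis :: "real \<times> (real ^ 'n)" where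
  "radial_axis \<equiv> (1, 0)"

definition space_axis :: "'n \<Rightarrow> real \<times> (real ^ 'n)" where
  "space_axis i = (0, axis i 1)"

lemma axes_Basis: "radial_axis \<in> Basis" "space_axis i \<in> Basis" "space_axis i \<noteq> radial_axis"
  by (auto simp: space_axis_def Basis_prod_def axis_in_Basis_iff)

lemma inner_axes: "x \<bullet> radial_axis = fst x" "x \<bullet> space_axis i = snd x $ i"
  by (simp_all add: space_axis_def inner_prod_def inner_axis)

lemma space_axis_inject: "space_axis i = space_axis j \<longleftrightarrow> i = j"
  by (auto simp: space_axis_def axis_eq_axis)

text \<open>
  Measurability of \<open>g\<close> on the half-line is read off along a ray in a coordinate direction.
\<close>

lemma generator_measurable:
  assumes "(\<lambda>x::'e::euclidean_space. g (x \<bullet> x)) \<in> borel_measurable borel"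
  shows "(\<lambda>t. ennreal (g (max 0 t))) \<in> borel_measurable borel"
proof -
  obtain b :: 'e where b: "b \<in> Basis" using SOME_Basis by blast
  have "(\<lambda>t. sqrt (max 0 t) *\<^sub>R b) \<in> borel_measurable borel" by measurable
  from measurable_compose[OF measurable_compose[OF this assms] measurable_ennreal] show ?thesis
    using b by (simp add: inner_Basis)
qed

text \<open>
  In degree zero the moment ratio is one, whatever the higher moments of \<open>R\<close> are.
\<close>

lemma spherical_half_space_total_mass:
  fixes g :: "real \<Rightarrow> real" and b0 b1 :: "'e::euclidean_space"
  assumes R: "distributed N lborel R (\<lambda>r. ennreal (radial_density k g r))"
    and R_nonneg: "\<And>\<omega>. \<omega> \<in> space N \<Longrightarrow> 0 \<le> R \<omega>" and N: "prob_space N"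
    and R0: "distributed N0 lborel (\<lambda>\<omega>. (R0 \<omega>)\<^sup>2) (\<lambda>x. ennreal (chi_square_density (k + 1) x))"
    and R0_nonneg: "\<And>\<omega>. \<omega> \<in> space N0 \<Longrightarrow> 0 \<le> R0 \<omega>" and N0: "prob_space N0"
    and k: "k + 1 = DIM('e)"
    and g: "(\<lambda>x::'e. g (x \<bullet> x)) \<in> borel_measurable borel" "\<And>t. 0 \<le> t \<Longrightarrow> 0 \<le> g t"
    and b: "b0 \<in> Basis" "b1 \<in> Basis" "b1 \<noteq> b0"
  shows "spherical_half_space g b0 (\<lambda>_. 1) 0"
proof
  fix p :: "'e \<Rightarrow> real" and m \<kappa>
  assume hw: "homogeneous_weight p m \<kappa>" and m: "m \<le> (0::nat)"
  interpret N: prob_space N by fact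
  interpret N0: prob_space N0 by fact
  show "(\<integral>\<^sup>+x. ennreal (p x) * ennreal (g (x \<bullet> x)) \<partial>lborel) =
      ennreal 1 * (\<integral>\<^sup>+x. ennreal (p x) * ennreal (gauss x) \<partial>lborel)"
    using homogeneous_weight.spherical_moment_ratio[OF hw R R_nonneg R0 R0_nonneg k generator_measurable[OF g(1)] g(2)] m
    by (simp add: N.emeasure_space_1 N0.emeasure_space_1)
qed (use g b in auto)

lemma chi_moment:
  assumes R0: "distributed N0 lborel (\<lambda>\<omega>. (R0 \<omega>)\<^sup>2) (\<lambda>x. ennreal (chi_square_density (k + 1) x))"
    and R0_nonneg: "\<And>\<omega>. \<omega> \<in> space N0 \<Longrightarrow> 0 \<le> R0 \<omega>"
    and R0_meas: "R0 \<in> borel_measurable N0"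
  shows "(\<integral>\<^sup>+\<omega>. ennreal (R0 \<omega> ^ m) \<partial>N0) = ennreal (\<integral>\<omega>. R0 \<omega> ^ m \<partial>N0)" "0 < (\<integral>\<omega>. R0 \<omega> ^ m \<partial>N0)"
proof -
  define q where "q = 2 powr (real (k + 1 + m) / 2) * Gamma (real (k + 1 + m) / 2) / (2 powr (real (k + 1) / 2) * Gamma (real (k + 1) / 2))"
  have k0: "0 < k + 1" by simp
  have q: "0 < q"
    using Gamma_real_pos[of "real (k + 1 + m) / 2"] Gamma_real_pos[of "real (k + 1) / 2"] by (simp add: q_def)
  have eq: "(\<integral>\<^sup>+\<omega>. ennreal (R0 \<omega> ^ m) \<partial>N0) = ennreal q"
    unfolding q_def by (rule nn_integral_chi_variable[OF R0 R0_nonneg k0])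
  have "(\<integral>\<omega>. R0 \<omega> ^ m \<partial>N0) = q"
    using R0_nonneg R0_meas q by (subst integral_eq_nn_integral) (auto simp: eq)
  then show "(\<integral>\<^sup>+\<omega>. ennreal (R0 \<omega> ^ m) \<partial>N0) = ennreal (\<integral>\<omega>. R0 \<omega> ^ m \<partial>N0)" "0 < (\<integral>\<omega>. R0 \<omega> ^ m \<partial>N0)"
    using eq q by auto
qed

lemma integrable_affine_cube:
  fixes Y :: "'m \<Rightarrow> real ^ 'n" and q :: "real ^ 'n"
  assumes M: "prob_space M"
    and 1: "\<And>i. integrable M (\<lambda>\<omega>. Y \<omega> $ i)"
    and 2: "\<And>i j. integrable M (\<lambda>\<omega>. Y \<omega> $ i * Y \<omega> $ j)"
    and 3: "\<And>i j l. integrable M (\<lambda>\<omega>. Y \<omega> $ i * Y \<omega> $ j * Y \<omega> $ l)"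
  shows "integrable M (\<lambda>\<omega>. (q \<bullet> Y \<omega> - t) ^ 3)"
proof -
  interpret prob_space M by fact
  define L where "L \<omega> = (\<Sum>i\<in>UNIV. q $ i * Y \<omega> $ i)" for \<omega>
  have L1: "integrable M L"
    unfolding L_def[abs_def] by (intro Bochner_Integration.integrable_sum integrable_mult_right 1)
  have "L \<omega> ^ 2 = (\<Sum>i\<in>UNIV. \<Sum>j\<in>UNIV. q $ i * q $ j * (Y \<omega> $ i * Y \<omega> $ j))" for \<omega>
    by (simp add: L_def power2_eq_square sum_product mult_ac)
  then have L2: "integrable M (\<lambda>\<omega>. L \<omega> ^ 2)"
    by (simp only:) (intro Bochner_Integration.integrable_sum integrable_mult_right 2)
  have "L \<omega> ^ 3 = (\<Sum>i\<in>UNIV. \<Sum>j\<in>UNIV. \<Sum>l\<in>UNIV. q $ i * q $ j * q $ l * (Y \<omega> $ i * Y \<omega> $ j * Y \<omega> $ l))" for \<omega>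
    by (simp add: L_def power3_eq_cube sum_product sum_distrib_left sum_distrib_right mult_ac)
  then have L3: "integrable M (\<lambda>\<omega>. L \<omega> ^ 3)"
    by (simp only:) (intro Bochner_Integration.integrable_sum integrable_mult_right 3)
  have "(q \<bullet> Y \<omega> - t) ^ 3 = L \<omega> ^ 3 + (- 3 * t) * L \<omega> ^ 2 + (3 * t\<^sup>2) * L \<omega> + (- (t ^ 3))" for \<omega>
    by (simp add: L_def inner_vec_def power3_eq_cube power2_eq_square algebra_simps)
  then show ?thesis
    by (simp only:) (intro Bochner_Integration.integrable_add integrable_mult_right L1 L2 L3 integrable_const)
qed

text \<open>
  On the quadrant where \<open>u\<close> and the coordinate \<open>v\<close> of index \<open>i0\<close> are positive,
  \<open>d * u + s * v \<ge> s * v\<close>.  So the moment of \<open>v ^ 3\<close> over the quadrant is finite, and by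
  \<open>spherical_moment_ratio\<close> it is a positive multiple of \<open>E[R\<^sup>3]\<close>.
\<close>

lemma radial_third_moment_finite:
  fixes g :: "real \<Rightarrow> real" and i0 :: "'n::finite"
  assumes R: "distributed N lborel R (\<lambda>r. ennreal (radial_density k g r))"
    and R_nonneg: "\<And>\<omega>. \<omega> \<in> space N \<Longrightarrow> 0 \<le> R \<omega>"
    and R0: "distributed N0 lborel (\<lambda>\<omega>. (R0 \<omega>)\<^sup>2) (\<lambda>x. ennreal (chi_square_density (k + 1) x))"
    and R0_nonneg: "\<And>\<omega>. \<omega> \<in> space N0 \<Longrightarrow> 0 \<le> R0 \<omega>"
    and R0_meas: "R0 \<in> borel_measurable N0"
    and k: "k = CARD('n)"
    and H: "spherical_half_space g (radial_axis :: real \<times> (real ^ 'n)) \<rho> D"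
    and int: "integrable (spherical_half_space.half_law g radial_axis) (\<lambda>x::real \<times> (real ^ 'n). (d * fst x + s * snd x $ i0) ^ 3)"
    and d: "0 \<le> d" and s: "0 < s"
  shows "(\<integral>\<^sup>+\<omega>. ennreal (R \<omega> ^ 3) \<partial>N) < \<infinity>"
proof -
  interpret H: spherical_half_space g "radial_axis :: real \<times> (real ^ 'n)" \<rho> D by (rule H)
  define e where "e = (space_axis i0 :: real \<times> (real ^ 'n))"
  have b: "radial_axis \<in> (Basis :: (real \<times> (real ^ 'n)) set)" "e \<in> Basis" "radial_axis \<noteq> e"
    using axes_Basis(1) axes_Basis(2)[of i0] axes_Basis(3)[of i0] by (auto simp: e_def)
  let ?p = "\<lambda>x::real \<times> (real ^ 'n). half_power 0 (x \<bullet> radial_axis) * half_power 3 (x \<bullet> e)"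
  have hp[measurable]: "half_power i \<in> borel_measurable borel" for i by (rule half_power.measurable_weight)
  interpret p: homogeneous_weight ?p "0 + 3" "real (DIM(real \<times> (real ^ 'n)) + (0 + 3)) / 2"
    by (rule homogeneous_weight_product[OF hp _ _ _ b(1,2)])
      (auto simp: half_power.weight_nonneg half_power_def power_mult_distrib zero_less_mult_iff)
  let ?X = "\<integral>\<^sup>+x. ennreal (?p x) * ennreal (g (x \<bullet> x)) \<partial>lborel"
  have "ennreal (2 * s ^ 3) * ?X = (\<integral>\<^sup>+x. ennreal (2 * s ^ 3) * (ennreal (?p x) * ennreal (g (x \<bullet> x))) \<partial>lborel)"
    by (rule nn_integral_cmult[symmetric]) measurable
  also have "\<dots> = (\<integral>\<^sup>+x. ennreal (s ^ 3 * ?p x) \<partial>H.half_law)"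
    using s p.weight_nonneg
    by (subst H.nn_integral_half_law) (auto intro!: nn_integral_cong simp: half_power_def mult_ac simp flip: ennreal_mult')
  also have "\<dots> \<le> (\<integral>\<^sup>+x. ennreal (norm ((d * fst x + s * snd x $ i0) ^ 3)) \<partial>H.half_law)"
  proof (intro nn_integral_mono ennreal_leI)
    fix x :: "real \<times> (real ^ 'n)"
    show "s ^ 3 * ?p x \<le> norm ((d * fst x + s * snd x $ i0) ^ 3)"
    proof (cases "0 < fst x \<and> 0 < snd x $ i0")
      case True
      then have "s * snd x $ i0 \<le> d * fst x + s * snd x $ i0" using d by simp
      then have "(s * snd x $ i0) ^ 3 \<le> (d * fst x + s * snd x $ i0) ^ 3"
        using True s by (intro power_mono) auto
      also have "\<dots> \<le> norm ((d * fst x + s * snd x $ i0) ^ 3)" by simp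
      finally show ?thesis using True by (simp add: half_power_def e_def inner_axes power_mult_distrib)
    qed (auto simp: half_power_def e_def inner_axes)
  qed
  also have "\<dots> < \<infinity>" using int by (simp add: integrable_iff_bounded)
  finally have X: "?X < \<infinity>" using s by (auto simp: ennreal_mult_less_top ennreal_eq_0_iff)
  have *: "(\<integral>\<^sup>+x. ennreal (?p x) * ennreal (gauss x) \<partial>lborel) =
    (\<integral>\<^sup>+u. ennreal (half_power 0 u * std_normal_density u) \<partial>lborel) *
    (\<integral>\<^sup>+v. ennreal (half_power 3 v * std_normal_density v) \<partial>lborel)"
    by (rule nn_integral_gauss_pair) (auto simp: half_power.weight_nonneg b)
  have Y: "(\<integral>\<^sup>+x. ennreal (?p x) * ennreal (gauss x) \<partial>lborel) = ennreal (1 / sqrt (2 * pi))"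
  proof -
    have "ennreal (1 / 2) * ennreal (2 / sqrt (2 * pi)) = ennreal (1 / sqrt (2 * pi))"
      by (subst ennreal_mult[symmetric]) auto
    with * show ?thesis unfolding half_normal_moments by simp
  qed
  have k': "k + 1 = DIM(real \<times> (real ^ 'n))" using k by simp
  have eq: "?X * ennreal (\<integral>\<omega>. R0 \<omega> ^ 3 \<partial>N0) = ennreal (1 / sqrt (2 * pi)) * (\<integral>\<^sup>+\<omega>. ennreal (R \<omega> ^ 3) \<partial>N)"
    using p.spherical_moment_ratio[OF R R_nonneg R0 R0_nonneg k' generator_measurable[OF H.density_measurable] H.density_nonneg]
    by (simp only: add_0 Y chi_moment(1)[OF R0 R0_nonneg R0_meas, of 3])
  have "?X * ennreal (\<integral>\<omega>. R0 \<omega> ^ 3 \<partial>N0) < \<infinity>"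
    using X by (simp add: ennreal_mult_less_top)
  then have "ennreal (1 / sqrt (2 * pi)) * (\<integral>\<^sup>+\<omega>. ennreal (R \<omega> ^ 3) \<partial>N) < \<infinity>"
    by (simp only: eq)
  then show ?thesis using pi_gt_zero by (auto simp: ennreal_mult_less_top ennreal_eq_0_iff)
qed

lemma spherical_half_space_moments:
  fixes g :: "real \<Rightarrow> real" and b0 b1 :: "'e::euclidean_space"
  assumes R: "distributed N lborel R (\<lambda>r. ennreal (radial_density k g r))"
    and R_nonneg: "\<And>\<omega>. \<omega> \<in> space N \<Longrightarrow> 0 \<le> R \<omega>" and N: "prob_space N"
    and R0: "distributed N0 lborel (\<lambda>\<omega>. (R0 \<omega>)\<^sup>2) (\<lambda>x. ennreal (chi_square_density (k + 1) x))"
    and R0_nonneg: "\<And>\<omega>. \<omega> \<in> space N0 \<Longrightarrow> 0 \<le> R0 \<omega>" and N0: "prob_space N0"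
    and R0_meas: "R0 \<in> borel_measurable N0"
    and k: "k + 1 = DIM('e)"
    and g: "(\<lambda>x::'e. g (x \<bullet> x)) \<in> borel_measurable borel" "\<And>t. 0 \<le> t \<Longrightarrow> 0 \<le> g t"
    and b: "b0 \<in> Basis" "b1 \<in> Basis" "b1 \<noteq> b0"
    and finite: "(\<integral>\<^sup>+\<omega>. ennreal (R \<omega> ^ 3) \<partial>N) < \<infinity>"
  shows "spherical_half_space g b0 (\<lambda>m. (\<integral>\<omega>. R \<omega> ^ m \<partial>N) / (\<integral>\<omega>. R0 \<omega> ^ m \<partial>N0)) 3"
proof
  interpret N: prob_space N by fact
  interpret N0: prob_space N0 by fact
  have Rm[measurable]: "R \<in> borel_measurable N" using distributed_measurable[OF R] by simp
  note chi = chi_moment[OF R0 R0_nonneg R0_meas]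
  have R3: "integrable N (\<lambda>\<omega>. R \<omega> ^ 3)"
  proof (rule integrableI_bounded)
    have "(\<integral>\<^sup>+\<omega>. ennreal (norm (R \<omega> ^ 3)) \<partial>N) = (\<integral>\<^sup>+\<omega>. ennreal (R \<omega> ^ 3) \<partial>N)"
      by (intro nn_integral_cong) (simp add: R_nonneg)
    then show "(\<integral>\<^sup>+\<omega>. ennreal (norm (R \<omega> ^ 3)) \<partial>N) < \<infinity>" using finite by simp
  qed measurable
  have Rint: "integrable N (\<lambda>\<omega>. R \<omega> ^ m)" if "m \<le> 3" for m
  proof (rule Bochner_Integration.integrable_bound)
    show "integrable N (\<lambda>\<omega>. 1 + R \<omega> ^ 3)" using R3 by simp
    show "AE \<omega> in N. norm (R \<omega> ^ m) \<le> norm (1 + R \<omega> ^ 3)"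
    proof (rule AE_I2)
      fix \<omega> assume "\<omega> \<in> space N"
      then have r: "0 \<le> R \<omega>" by (rule R_nonneg)
      have "R \<omega> ^ m \<le> 1 + R \<omega> ^ 3"
      proof (cases "R \<omega> \<le> 1")
        case True
        then have "R \<omega> ^ m \<le> 1" using r by (intro power_le_one)
        then show ?thesis using zero_le_power[OF r, of 3] by linarith
      next
        case False
        then have "R \<omega> ^ m \<le> R \<omega> ^ 3" using that by (intro power_increasing) auto
        then show ?thesis by linarith
      qed
      then show "norm (R \<omega> ^ m) \<le> norm (1 + R \<omega> ^ 3)" using r by simp
    qed
  qed measurable
  show "0 \<le> (\<integral>\<omega>. R \<omega> ^ m \<partial>N) / (\<integral>\<omega>. R0 \<omega> ^ m \<partial>N0)" for m
    using R_nonneg R0_nonneg by (intro divide_nonneg_nonneg integral_nonneg_AE AE_I2) auto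
  show "(\<integral>\<omega>. R \<omega> ^ 0 \<partial>N) / (\<integral>\<omega>. R0 \<omega> ^ 0 \<partial>N0) = 1"
    by (simp add: N.prob_space N0.prob_space)
  fix p :: "'e \<Rightarrow> real" and m \<kappa>
  assume hw: "homogeneous_weight p m \<kappa>" and m: "m \<le> (3::nat)"
  let ?X = "\<integral>\<^sup>+x. ennreal (p x) * ennreal (g (x \<bullet> x)) \<partial>lborel"
    and ?Y = "\<integral>\<^sup>+x. ennreal (p x) * ennreal (gauss x) \<partial>(lborel :: 'e measure)"
  define r where "r = (\<integral>\<omega>. R \<omega> ^ m \<partial>N)"
  define r0 where "r0 = (\<integral>\<omega>. R0 \<omega> ^ m \<partial>N0)"
  have r0: "0 < r0" unfolding r0_def by (rule chi(2))
  have "(\<integral>\<^sup>+\<omega>. ennreal (R \<omega> ^ m) \<partial>N) = ennreal r"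
    unfolding r_def using Rint[OF m] R_nonneg by (intro nn_integral_eq_integral AE_I2) auto
  then have "?X * ennreal r0 = ?Y * ennreal r"
    using homogeneous_weight.spherical_moment_ratio[OF hw R R_nonneg R0 R0_nonneg k generator_measurable[OF g(1)] g(2)]
    by (simp add: chi(1) r0_def)
  then have "?X * ennreal r0 * ennreal (1 / r0) = ?Y * ennreal r * ennreal (1 / r0)" by simp
  then have "?X = ennreal (r / r0) * ?Y"
    using r0 by (simp add: mult.assoc flip: ennreal_mult' ennreal_mult'') (simp add: mult.commute)
  then show "?X = ennreal ((\<integral>\<omega>. R \<omega> ^ m \<partial>N) / (\<integral>\<omega>. R0 \<omega> ^ m \<partial>N0)) * ?Y"
    by (simp only: r_def r0_def)
qed (use g b in auto)

theorem proposition1: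
  fixes M :: "'m measure" and N :: "'r measure" and N0 :: "'s measure"
    and Y :: "'m \<Rightarrow> real ^ 'n" and R :: "'r \<Rightarrow> real" and R0 :: "'s \<Rightarrow> real"
    and \<mu> \<delta> :: "real ^ 'n" and \<Omega> :: "real ^ 'n ^ 'n" and g :: "real \<Rightarrow> real"
    and k :: nat and a b c \<delta>s :: real
  assumes k: "k = CARD('n)"
    and \<Omega>: "symmetric_positive_definite \<Omega>"
    and \<delta>: "\<delta> \<bullet> (matrix_inv \<Omega> *v \<delta>) < 1"
    and g: "spherical_density_generator TYPE(real \<times> (real ^ 'n)) g"
    and M: "prob_space M"
    and Y: "distributed M lborel Y (skew_elliptical_density \<mu> \<Omega> \<delta> g)"
    and moment1: "\<And>i. integrable M (\<lambda>\<omega>. Y \<omega> $ i)"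
    and moment2: "\<And>i j. integrable M (\<lambda>\<omega>. Y \<omega> $ i * Y \<omega> $ j)"
    and moment3: "\<And>i j l. integrable M (\<lambda>\<omega>. Y \<omega> $ i * Y \<omega> $ j * Y \<omega> $ l)"
    and N: "prob_space N"
    and R_nonneg: "\<And>\<omega>. \<omega> \<in> space N \<Longrightarrow> 0 \<le> R \<omega>"
    and R: "distributed N lborel R (\<lambda>r. ennreal (radial_density k g r))"
    and N0: "prob_space N0"
    and R0_nonneg: "\<And>\<omega>. \<omega> \<in> space N0 \<Longrightarrow> 0 \<le> R0 \<omega>"
    and R0_measurable: "R0 \<in> borel_measurable N0"
    and R0: "distributed N0 lborel (\<lambda>\<omega>. (R0 \<omega>)\<^sup>2) (\<lambda>x. ennreal (chi_square_density (k + 1) x))"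
    and \<delta>s: "\<delta>s = sqrt (\<delta> \<bullet> (matrix_inv \<Omega> *v \<delta>))"
    and a: "a = (\<integral>\<omega>. R \<omega> \<partial>N) / (\<integral>\<omega>. R0 \<omega> \<partial>N0) * sqrt (2 / pi)"
    and b: "b = (\<integral>\<omega>. R \<omega> ^ 2 \<partial>N) / (\<integral>\<omega>. R0 \<omega> ^ 2 \<partial>N0)"
    and c: "c = (\<integral>\<omega>. R \<omega> ^ 3 \<partial>N) / (\<integral>\<omega>. R0 \<omega> ^ 3 \<partial>N0) * sqrt (2 / pi)"
  shows "mardia_skewness (distr M borel Y) =
           (3 * (c - a * b) * \<delta>s + (2 * a ^ 3 - c) * \<delta>s ^ 3)\<^sup>2 / (b - a\<^sup>2 * \<delta>s\<^sup>2) ^ 3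
         + 3 * (real k - 1) * (c - a * b)\<^sup>2 * \<delta>s\<^sup>2 / (b\<^sup>2 * (b - a\<^sup>2 * \<delta>s\<^sup>2))"
proof -
  interpret M: prob_space M by (rule M)
  define s where "s = sqrt (1 - \<delta> \<bullet> (matrix_inv \<Omega> *v \<delta>))"
  obtain A :: "real ^ 'n ^ 'n" and i0 where A: "invertible A" and \<Omega>_pos: "0 < det \<Omega>"
    and form: "\<And>z. (A *v z) \<bullet> (matrix_inv \<Omega> *v (A *v z)) = z \<bullet> z"
    and \<delta>A: "\<And>z. \<delta> \<bullet> (matrix_inv \<Omega> *v (A *v z)) = \<delta>s * z $ i0"
    and \<delta>s_nonneg: "0 \<le> \<delta>s"
    by (rule skew_elliptical_whitening[OF \<Omega> \<delta>s]) blast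
  have s: "0 < s" using \<delta> by (simp add: s_def)
  have circle: "\<delta>s\<^sup>2 + s\<^sup>2 = 1"
    using \<delta> \<delta>s_nonneg by (simp add: s_def \<delta>s)
  let ?R = "radial_axis :: real \<times> (real ^ 'n)"
  define e where "e = (space_axis i0 :: real \<times> (real ^ 'n))"
  have e: "e \<in> Basis" "e \<noteq> ?R" using axes_Basis(2)[of i0] axes_Basis(3)[of i0] by (simp_all add: e_def)
  have g_meas: "(\<lambda>x::real \<times> (real ^ 'n). g (x \<bullet> x)) \<in> borel_measurable borel"
    and g_nonneg: "\<And>t. 0 \<le> t \<Longrightarrow> 0 \<le> g t"
    using g by (auto simp: spherical_density_generator_def)
  have k': "k + 1 = DIM(real \<times> (real ^ 'n))" by (simp add: k)
  have H0: "spherical_half_space g ?R (\<lambda>_. 1) 0"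
    by (rule spherical_half_space_total_mass[OF R R_nonneg N R0 R0_nonneg N0 k' g_meas g_nonneg axes_Basis(1) e])
  interpret H0: spherical_half_space g ?R "\<lambda>_. 1" 0 by (rule H0)
  have dens: "distr M borel Y = density lborel (skew_elliptical_density \<mu> \<Omega> \<delta> g)"
    using distributed_distr_eq_density[OF Y] by (simp cong: distr_cong)
  have Ym[measurable]: "Y \<in> borel_measurable M"
    using distributed_measurable[OF Y] by simp
  let ?T = "\<lambda>x. \<mu> + A *v snd (plane_reflection \<delta>s s i0 x)"
  have law: "distr M borel Y = distr H0.half_law borel ?T"
    unfolding dens H0.half_law_def
  proof (rule skew_elliptical_law[OF _ g_meas g_nonneg circle s s_def _ _ \<Omega>_pos A form \<delta>A])
    show "skew_elliptical_density \<mu> \<Omega> \<delta> g \<in> borel_measurable borel"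
      using distributed_borel_measurable[OF Y] by simp
    show "prob_space (density lborel (skew_elliptical_density \<mu> \<Omega> \<delta> g))"
      unfolding dens[symmetric] by (rule M.prob_space_distr) simp
    show "prob_space (density lborel (\<lambda>x. ennreal (2 * half_power 0 (x \<bullet> ?R) * g (x \<bullet> x))))"
      using H0.prob_space_half_law by (simp add: H0.half_law_def)
  qed
  have Tm[measurable]: "?T \<in> borel_measurable borel"
    by (intro borel_measurable_add borel_measurable_const
        measurable_compose[OF plane_reflection_measurable matrix_vector_mult_measurable])
  have R3: "(\<integral>\<^sup>+\<omega>. ennreal (R \<omega> ^ 3) \<partial>N) < \<infinity>"
  proof -
    \<comment> \<open>The linear functional \<open>q\<close> reads off the coordinate \<open>i0\<close> of \<open>A\<inverse> y\<close>.\<close>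
    define q where "q = matrix_inv A $ i0"
    have "(\<lambda>y. q \<bullet> y - q \<bullet> \<mu>) \<in> borel_measurable borel"
      by (intro borel_measurable_continuous_onI continuous_intros)
    then have cube: "(\<lambda>y. (q \<bullet> y - q \<bullet> \<mu>) ^ 3) \<in> borel_measurable borel" by measurable
    have "integrable M (\<lambda>\<omega>. (q \<bullet> Y \<omega> - q \<bullet> \<mu>) ^ 3)"
      by (rule integrable_affine_cube[OF M moment1 moment2 moment3])
    then have "integrable (distr M borel Y) (\<lambda>y. (q \<bullet> y - q \<bullet> \<mu>) ^ 3)"
      using cube by (simp add: integrable_distr_eq)
    then have "integrable H0.half_law (\<lambda>x. (q \<bullet> ?T x - q \<bullet> \<mu>) ^ 3)"
      unfolding law using cube by (simp add: integrable_distr_eq)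
    moreover have "q \<bullet> ?T x - q \<bullet> \<mu> = \<delta>s * fst x + s * snd x $ i0" for x
    proof -
      have "q \<bullet> ?T x - q \<bullet> \<mu> = (matrix_inv A *v (A *v snd (plane_reflection \<delta>s s i0 x))) $ i0"
        by (simp add: q_def matrix_vector_mul_component inner_add_right)
      also have "\<dots> = snd (plane_reflection \<delta>s s i0 x) $ i0"
        by (simp add: matrix_vector_mul_assoc matrix_inv_left[OF A])
      finally show ?thesis by (simp add: plane_reflection_coordinate)
    qed
    ultimately have int: "integrable H0.half_law (\<lambda>x. (\<delta>s * fst x + s * snd x $ i0) ^ 3)" by simp
    show ?thesis
      using radial_third_moment_finite[OF R R_nonneg R0 R0_nonneg R0_measurable k H0 int \<delta>s_nonneg s] .
  qed
  interpret H: spherical_half_space g ?R "\<lambda>m. (\<integral>\<omega>. R \<omega> ^ m \<partial>N) / (\<integral>\<omega>. R0 \<omega> ^ m \<partial>N0)" 3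
    by (rule spherical_half_space_moments[OF R R_nonneg N R0 R0_nonneg N0 R0_measurable k' g_meas g_nonneg axes_Basis(1) e R3])
  have abc: "H.\<aa> = a" "H.\<bb> = b" "H.\<cc> = c"
    by (simp_all add: H.\<aa>_def H.\<bb>_def H.\<cc>_def a b c)
  define W :: "real \<times> (real ^ 'n) \<Rightarrow> real ^ 'n" where "W x = (\<chi> i. H.skew_coord \<delta>s s e (space_axis i) x)" for x
  define \<sigma> where "\<sigma> i = (if i = i0 then b - a\<^sup>2 * \<delta>s\<^sup>2 else b)" for i
  have W: "W x $ i = H.skew_coord \<delta>s s e (space_axis i) x" for x i by (simp add: W_def)
  have W_meas: "W \<in> borel_measurable H.half_law"
    by (subst borel_measurable_euclidean_space) (auto simp: Basis_vec_def inner_axis W)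
  have axis: "space_axis i \<in> Basis" "space_axis i \<noteq> ?R" "(space_axis i = e) = (i = i0)" for i
    using axes_Basis(2)[of i] axes_Basis(3)[of i] by (simp_all add: e_def space_axis_inject)
  have "?T x = (\<mu> + A *v ((a * \<delta>s) *\<^sub>R axis i0 1)) + A *v W x" for x
  proof -
    have "snd (plane_reflection \<delta>s s i0 x) = (a * \<delta>s) *\<^sub>R axis i0 1 + W x"
      by (auto simp: vec_eq_iff plane_reflection_coordinate W H.skew_coord_def e_def space_axis_inject inner_axes axis_def abc)
    then show ?thesis by (simp add: matrix_vector_right_distrib add.assoc)
  qed
  then have "distr M borel Y = distr H.half_law borel (\<lambda>x. (\<mu> + A *v ((a * \<delta>s) *\<^sub>R axis i0 1)) + A *v W x)"
    using law by (simp only:)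
  then have "mardia_skewness (distr M borel Y) =
    (\<Sum>i\<in>UNIV. \<Sum>j\<in>UNIV. \<Sum>l\<in>UNIV. (\<integral>x. W x $ i * W x $ j * W x $ l \<partial>H.half_law)\<^sup>2 / (\<sigma> i * \<sigma> j * \<sigma> l))"
  proof (simp only:, intro mardia_skewness_affine[OF H.prob_space_half_law W_meas A])
    show "(\<integral>x. W x $ i * W x $ j \<partial>H.half_law) = (if i = j then \<sigma> i else 0)" for i j
      using H.skew_coord_variance[OF order_refl circle e, of "space_axis i"] H.skew_coord_covariance[OF order_refl circle e, of "space_axis i" "space_axis j"] axis
      by (cases "i = j") (simp_all add: W \<sigma>_def abc space_axis_inject)
    show "\<sigma> i \<noteq> 0" for i
      using H.second_moment_pos[OF order_refl] H.skewed_variance_pos[OF order_refl circle e s] by (simp add: \<sigma>_def abc)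
    show "integrable H.half_law (\<lambda>x. W x $ i)" for i
      unfolding W by (rule H.integrable_skew_coord[OF order_refl circle e axis(1)])
    show "integrable H.half_law (\<lambda>x. W x $ i * W x $ j)" for i j
      unfolding W by (rule H.integrable_skew_coord2[OF order_refl circle e axis(1) axis(1)])
    show "integrable H.half_law (\<lambda>x. W x $ i * W x $ j * W x $ l)" for i j l
      unfolding W by (rule H.integrable_skew_coord3[OF order_refl circle e axis(1) axis(1) axis(1)])
    show "(\<integral>x. W x $ i \<partial>H.half_law) = 0" for i
      unfolding W by (rule H.skew_coord_mean[OF order_refl circle e axis(1,2)])
  qed
  also have "\<dots> = (3 * (c - a * b) * \<delta>s + (2 * a ^ 3 - c) * \<delta>s ^ 3)\<^sup>2 / (b - a\<^sup>2 * \<delta>s\<^sup>2) ^ 3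
      + 3 * (real CARD('n) - 1) * ((c - a * b) * \<delta>s)\<^sup>2 / (b\<^sup>2 * (b - a\<^sup>2 * \<delta>s\<^sup>2))"
  proof (rule mardia_sum[where e=i0])
    show "(\<integral>x. W x $ i0 * W x $ i0 * W x $ i0 \<partial>H.half_law) = 3 * (c - a * b) * \<delta>s + (2 * a ^ 3 - c) * \<delta>s ^ 3"
      using H.skew_coord_third_eee[OF order_refl circle e] by (simp add: W abc e_def[symmetric])
    fix w assume w: "w \<noteq> i0"
    have *: "(\<integral>x. W x $ i0 * W x $ w * W x $ w \<partial>H.half_law) = (c - a * b) * \<delta>s"
      using H.skew_coord_third_eww[OF order_refl circle e, of "space_axis w"] axis w by (simp add: W abc e_def[symmetric])
    then show "(\<integral>x. W x $ i0 * W x $ w * W x $ w \<partial>H.half_law) = (c - a * b) * \<delta>s" .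
    show "(\<integral>x. W x $ w * W x $ i0 * W x $ w \<partial>H.half_law) = (c - a * b) * \<delta>s"
      "(\<integral>x. W x $ w * W x $ w * W x $ i0 \<partial>H.half_law) = (c - a * b) * \<delta>s"
      using * by (simp_all add: mult_ac)
  next
    fix i j l assume "\<not> (i = i0 \<and> j = l)" "\<not> (j = i0 \<and> i = l)" "\<not> (l = i0 \<and> i = j)"
    then show "(\<integral>x. W x $ i * W x $ j * W x $ l \<partial>H.half_law) = 0"
      unfolding W by (intro H.skew_coord_third_zero[OF order_refl circle e]) (auto simp: axis space_axis_inject)
  qed (simp add: \<sigma>_def)
  finally show ?thesis
    by (simp add: k power_mult_distrib mult.assoc)
qed

end
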